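(* Let $\omega$ be a non-quasianalytic weight function satisfying $\log(1+t)=o(\omega(t))$ as $t\to\infty$. Then the following properties hold true: (i) The convolution operator $C\colon\mathcal{O}_{M,\omega}(\mathbb{R}^N)\times\mathcal{O}'_{M,\omega}(\mathbb{R}^N)\to\mathcal{O}_{M,\omega}(\mathbb{R}^N)$, $(f,T)\mapsto T\star f$, is discontinuous. (ii) The convolution operator $C\colon\mathcal{O}_{C,\omega}(\mathbb{R}^N)\times\mathcal{O}'_{C,\omega}(\mathbb{R}^N)\to\mathcal{O}_{C,\omega}(\mathbb{R}^N)$, $(f,T)\mapsto T\star f$, is discontinuous. (Discontinuous means not jointly continuous for the product topology.)
   Context: Weights. A non-quasianalytic weight function is a continuous increasing function $\omega:[0,\infty)\to[0,\infty)$ such that: ($\alpha$) there is $K\ge 1$ with $\omega(2t)\le K(1+\omega(t))$ for all $t\ge 0$; ($\beta$) $\int_1^\infty \frac{\omega(t)}{1+t^2}\,dt<\infty$; ($\gamma$) there are $a\in\mathbb{R}$, $b>0$ with $\omega(t)\ge a+b\log(1+t)$ for all $t\ge 0$; ($\delta$) $\varphi_\omega(t)=\omega(e^t)$ is convex. It is assumed (normalization) that $\omega$ vanishes on $[0,1]$. For $x\in\mathbb{R}^N$, $\omega(x):=\omega(|x|)$. The Young conjugate is $\varphi^*_\omega(s):=\sup_{t\ge 0}\{st-\varphi_\omega(t)\}$, $s\ge 0$ (the value $+\infty$ is allowed, with $\exp(-\infty)=0$). Spaces. For $m,n\in\mathbb{N}$ let $\mathcal{O}^m_{n,\omega}(\mathbb{R}^N)$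 be the space of all $f\in C^\infty(\mathbb{R}^N)$ with $r_{m,n}(f):=\sup_{\alpha\in\mathbb{N}_0^N}\sup_{x\in\mathbb{R}^N}|\partial^\alpha f(x)|\exp\left(-n\omega(x)-m\varphi^*_\omega\left(\frac{|\alpha|}{m}\right)\right)<\infty$, with norm $r_{m,n}$. Set $\mathcal{O}_{M,\omega}(\mathbb{R}^N):=\bigcap_{m}\bigcup_{n}\mathcal{O}^m_{n,\omega}(\mathbb{R}^N)$ with the topology of the projective limit over $m$ of the locally convex inductive limits $\mathrm{ind}_{n}\,\mathcal{O}^m_{n,\omega}(\mathbb{R}^N)$, and $\mathcal{O}_{C,\omega}(\mathbb{R}^N):=\bigcup_{n}\bigcap_{m}\mathcal{O}^m_{n,\omega}(\mathbb{R}^N)$ with the topology of the locally convex inductive limit over $n$ of the projective limits $\mathrm{proj}_m\,\mathcal{O}^m_{n,\omega}(\mathbb{R}^N)$. A prime denotes the strong dual. For $E=\mathcal{O}_{M,\omega}(\mathbb{R}^N)$ or $E=\mathcal{O}_{C,\omega}(\mathbb{R}^N)$, $f\in E$, $T\in E'$, the convolution is $(T\star f)(x):=\langle T_y,f(x-y)\rangle$, $x\in\mathbb{R}^N$ ($T$ acting in the variable $y$); under the stated hypothesis on $\omega$, $T\star f\in E$, so the maps are well-defined. *)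

theory Defs
  imports "HOL-Analysis.Analysis" "HOL-Library.Landau_Symbols"
begin

section \<open>Weight functions and the Young conjugate\<close>

text \<open>The weight lives on \<open>[0,\<infinity>)\<close>; values of \<open>\<omega>\<close> at negative arguments are never used.
  Because \<open>\<omega>\<close> vanishes on \<open>[0,1]\<close> and is nonnegative and increasing, convexity of
  \<open>t \<mapsto> \<omega>(e\<^sup>t)\<close> on the real line and on \<open>[0,\<infinity>)\<close> are the same condition.\<close>

definition nonquasianalytic_weight :: "(real \<Rightarrow> real) \<Rightarrow> bool" where
  "nonquasianalytic_weight \<omega> \<longleftrightarrow>
     continuous_on {0..} \<omega> \<and> mono_on {0..} \<omega> \<and> (\<forall>t\<ge>0. \<omega> t \<ge> 0) \<and>
     (\<exists>K\<ge>1. \<forall>t\<ge>0. \<omega> (2 * t) \<le> K * (1 + \<omega> t)) \<and>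
     set_integrable lborel {1..} (\<lambda>t. \<omega> t / (1 + t\<^sup>2)) \<and>
     (\<exists>a b. b > 0 \<and> (\<forall>t\<ge>0. \<omega> t \<ge> a + b * ln (1 + t))) \<and>
     convex_on UNIV (\<lambda>t. \<omega> (exp t)) \<and>
     (\<forall>t\<in>{0..1}. \<omega> t = 0)"

definition young_conjugate :: "(real \<Rightarrow> real) \<Rightarrow> real \<Rightarrow> ereal" where
  "young_conjugate \<omega> s = (SUP t\<in>{0..}. ereal (s * t - \<omega> (exp t)))"

text \<open>\<open>exp (- n \<omega>(x) - m \<phi>*(k/m))\<close>, with \<open>exp (-\<infinity>) = 0\<close>. The conjugate never takes
  the value \<open>-\<infinity>\<close>.\<close>

definition weight_factor ::
    "(real \<Rightarrow> real) \<Rightarrow> nat \<Rightarrow> nat \<Rightarrow> nat \<Rightarrow> 'a::real_normed_vector \<Rightarrow> real" where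
  "weight_factor \<omega> m n k x =
     (if young_conjugate \<omega> (real k / real m) = \<infinity> then 0
      else exp (- real n * \<omega> (norm x)
                - real m * real_of_ereal (young_conjugate \<omega> (real k / real m))))"


section \<open>Smooth functions and multi-index derivatives\<close>

definition partial_derivative ::
    "'n::finite \<Rightarrow> (real^'n \<Rightarrow> complex) \<Rightarrow> real^'n \<Rightarrow> complex" where
  "partial_derivative i f x = vector_derivative (\<lambda>t. f (x + t *\<^sub>R axis i 1)) (at 0)"

text \<open>All iterated partial derivatives, in any order, exist and are continuous.\<close>

definition smooth_function :: "(real^'n::finite \<Rightarrow> complex) \<Rightarrow> bool" where
  "smooth_function f \<longleftrightarrow>
     (\<forall>is. continuous_on UNIV (foldr partial_derivative is f) \<and>
        (\<forall>i x. (\<lambda>t. foldr partial_derivative is f (x + t *\<^sub>R axis i 1)) differentiable at 0))"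

text \<open>\<open>\<partial>\<^sup>\<alpha>\<close> applies the operators \<open>\<partial>\<^sub>i\<^bsup>\<alpha> i\<^esup>\<close> one coordinate after the other. The index type
  carries no order, so a fixed enumeration of it is chosen; on smooth functions the
  result does not depend on this choice, as partial derivatives commute.\<close>

definition coordinates :: "'n::finite list" where
  "coordinates = (SOME is. set is = UNIV \<and> distinct is)"

definition multi_derivative ::
    "('n \<Rightarrow> nat) \<Rightarrow> (real^'n::finite \<Rightarrow> complex) \<Rightarrow> real^'n \<Rightarrow> complex" where
  "multi_derivative \<alpha> f = foldr (\<lambda>i. partial_derivative i ^^ \<alpha> i) coordinates f"


section \<open>Locally convex topologies on spaces of functions\<close>

text \<open>A function space is the \<open>topspace\<close> of an abstract topology on the type of all complex
  valued functions, with pointwise operations. The Hausdorff property is not part of the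
  definition; it plays no role in the limits taken below.\<close>

definition locally_convex_topology :: "('a \<Rightarrow> complex) topology \<Rightarrow> bool" where
  "locally_convex_topology X \<longleftrightarrow>
     (\<lambda>_. 0) \<in> topspace X \<and>
     continuous_map (prod_topology X X) X (\<lambda>(f, g). \<lambda>x. f x + g x) \<and>
     continuous_map (prod_topology euclidean X) X (\<lambda>(c, f). \<lambda>x. c * f x) \<and>
     (\<forall>U. openin X U \<and> (\<lambda>_. 0) \<in> U \<longrightarrow>
        (\<exists>W V. openin X W \<and> (\<lambda>_. 0) \<in> W \<and> W \<subseteq> V \<and> V \<subseteq> U \<and>
           (\<forall>f\<in>V. \<forall>g\<in>V. \<forall>t\<in>{0..1}.
              (\<lambda>x. complex_of_real (1 - t) * f x + complex_of_real t * g x) \<in> V)))"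

text \<open>The finest locally convex topology on the union for which all inclusions are continuous,
  obtained as the supremum of all locally convex topologies with that property.\<close>

definition lc_inductive_limit ::
    "'i set \<Rightarrow> ('i \<Rightarrow> ('a \<Rightarrow> complex) topology) \<Rightarrow> ('a \<Rightarrow> complex) topology" where
  "lc_inductive_limit I T =
     topology_generated_by
       (\<Union>X\<in>{X. locally_convex_topology X \<and> topspace X = (\<Union>i\<in>I. topspace (T i)) \<and>
                (\<forall>i\<in>I. continuous_map (T i) X id)}. {U. openin X U})"

text \<open>The coarsest topology on the intersection for which all inclusions are continuous.\<close>

definition projective_limit ::
    "'i set \<Rightarrow> ('i \<Rightarrow> ('a \<Rightarrow> complex) topology) \<Rightarrow> ('a \<Rightarrow> complex) topology" where
  "projective_limit I T =
     topology_generated_by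
       (\<Union>i\<in>I. {U. openin (subtopology (T i) (\<Inter>j\<in>I. topspace (T j))) U})"

definition bounded_subset :: "('a \<Rightarrow> complex) topology \<Rightarrow> ('a \<Rightarrow> complex) set \<Rightarrow> bool" where
  "bounded_subset X B \<longleftrightarrow>
     B \<subseteq> topspace X \<and>
     (\<forall>U. openin X U \<and> (\<lambda>_. 0) \<in> U \<longrightarrow>
        (\<exists>r>0. B \<subseteq> (\<lambda>g x. complex_of_real r * g x) ` U))"

text \<open>Functionals are made canonical outside the space by being \<open>extensional\<close>.\<close>

definition continuous_dual ::
    "('a \<Rightarrow> complex) topology \<Rightarrow> (('a \<Rightarrow> complex) \<Rightarrow> complex) set" where
  "continuous_dual X =
     {T \<in> extensional (topspace X).
        continuous_map X euclidean T \<and>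
        (\<forall>f\<in>topspace X. \<forall>g\<in>topspace X. T (\<lambda>x. f x + g x) = T f + T g) \<and>
        (\<forall>c. \<forall>f\<in>topspace X. T (\<lambda>x. c * f x) = c * T f)}"

text \<open>Generated by the open balls of the seminorms \<open>T \<mapsto> sup\<^bsub>f \<in> B\<^esub> \<bar>T f\<bar>\<close>, \<open>B\<close> bounded.\<close>

definition strong_dual ::
    "('a \<Rightarrow> complex) topology \<Rightarrow> (('a \<Rightarrow> complex) \<Rightarrow> complex) topology" where
  "strong_dual X =
     topology_generated_by
       {{S \<in> continuous_dual X. (SUP f\<in>B. ereal (cmod (S f - T f))) < ereal \<epsilon>} | B T \<epsilon>.
          bounded_subset X B \<and> T \<in> continuous_dual X \<and> \<epsilon> > 0}"


section \<open>The spaces\<close>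

definition O_norm ::
    "(real \<Rightarrow> real) \<Rightarrow> nat \<Rightarrow> nat \<Rightarrow> (real^'n::finite \<Rightarrow> complex) \<Rightarrow> ereal" where
  "O_norm \<omega> m n f =
     (SUP \<alpha>. SUP x. ereal (cmod (multi_derivative \<alpha> f x) * weight_factor \<omega> m n (\<Sum>i\<in>UNIV. \<alpha> i) x))"

definition O_step :: "(real \<Rightarrow> real) \<Rightarrow> nat \<Rightarrow> nat \<Rightarrow> (real^'n::finite \<Rightarrow> complex) set" where
  "O_step \<omega> m n = {f. smooth_function f \<and> O_norm \<omega> m n f < \<infinity>}"

text \<open>The topology of the normed space: open sets are those containing a norm ball around each
  of their points.\<close>

definition O_step_topology ::
    "(real \<Rightarrow> real) \<Rightarrow> nat \<Rightarrow> nat \<Rightarrow> (real^'n::finite \<Rightarrow> complex) topology" where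
  "O_step_topology \<omega> m n =
     topology (\<lambda>U. U \<subseteq> O_step \<omega> m n \<and>
       (\<forall>f\<in>U. \<exists>\<epsilon>>0. \<forall>g\<in>O_step \<omega> m n. O_norm \<omega> m n (\<lambda>x. g x - f x) < ereal \<epsilon> \<longrightarrow> g \<in> U))"

definition O_M :: "(real \<Rightarrow> real) \<Rightarrow> (real^'n::finite \<Rightarrow> complex) topology" where
  "O_M \<omega> = projective_limit {1..} (\<lambda>m. lc_inductive_limit {1..} (\<lambda>n. O_step_topology \<omega> m n))"

definition O_C :: "(real \<Rightarrow> real) \<Rightarrow> (real^'n::finite \<Rightarrow> complex) topology" where
  "O_C \<omega> = lc_inductive_limit {1..} (\<lambda>n. projective_limit {1..} (\<lambda>m. O_step_topology \<omega> m n))"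


section \<open>Convolution and discontinuity\<close>

definition convolution ::
    "((real^'n::finite \<Rightarrow> complex) \<Rightarrow> complex) \<Rightarrow> (real^'n \<Rightarrow> complex) \<Rightarrow> real^'n \<Rightarrow> complex" where
  "convolution T f x = T (\<lambda>y. f (x - y))"

text \<open>Some open set has a preimage that is not open. The negation of \<^const>\<open>continuous_map\<close>
  would also hold for a map that leaves the target space; see the two lemmas below.\<close>

definition discontinuous_map :: "'a topology \<Rightarrow> 'b topology \<Rightarrow> ('a \<Rightarrow> 'b) \<Rightarrow> bool" where
  "discontinuous_map X Y F \<longleftrightarrow>
     (\<exists>U. openin Y U \<and> \<not> openin X {x \<in> topspace X. F x \<in> U})"

lemma discontinuous_map_imp_not_continuous_map:
  "discontinuous_map X Y F \<Longrightarrow> \<not> continuous_map X Y F"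
  by (auto simp: discontinuous_map_def continuous_map_def)

lemma discontinuous_map_iff_not_continuous_map:
  "F \<in> topspace X \<rightarrow> topspace Y \<Longrightarrow> discontinuous_map X Y F \<longleftrightarrow> \<not> continuous_map X Y F"
  by (auto simp: discontinuous_map_def continuous_map_def)


section \<open>The topologies live on the intended spaces\<close>

lemma foldr_partial_derivative_lincomb:
  assumes "smooth_function f" "smooth_function g"
  shows "foldr partial_derivative is (\<lambda>x. a * f x + b * g x) =
         (\<lambda>x. a * foldr partial_derivative is f x + b * foldr partial_derivative is g x)"
proof (induction "is")
  case Nil
  then show ?case by simp
next
  case (Cons i "is")
  let ?F = "foldr partial_derivative is f" and ?G = "foldr partial_derivative is g"
  show ?case
  proof
    fix x
    have f: "((\<lambda>t. ?F (x + t *\<^sub>R axis i 1)) has_vector_derivative partial_derivative i ?F x) (at 0)"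
      and g: "((\<lambda>t. ?G (x + t *\<^sub>R axis i 1)) has_vector_derivative partial_derivative i ?G x) (at 0)"
      using assms by (auto simp: smooth_function_def partial_derivative_def vector_derivative_works)
    have "((\<lambda>t. a * ?F (x + t *\<^sub>R axis i 1) + b * ?G (x + t *\<^sub>R axis i 1)) has_vector_derivative
        a * partial_derivative i ?F x + b * partial_derivative i ?G x) (at 0)"
      by (intro has_vector_derivative_add has_vector_derivative_mult_right f g)
    then show "foldr partial_derivative (i # is) (\<lambda>x. a * f x + b * g x) x =
      a * foldr partial_derivative (i # is) f x + b * foldr partial_derivative (i # is) g x"
      unfolding foldr_Cons comp_apply Cons.IH
      by (subst partial_derivative_def) (rule vector_derivative_at)
  qed
qed

lemma smooth_function_lincomb:
  assumes "smooth_function f" "smooth_function g"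
  shows "smooth_function (\<lambda>x. a * f x + b * g x)"
  unfolding smooth_function_def foldr_partial_derivative_lincomb[OF assms]
  using assms unfolding smooth_function_def
  by (intro allI conjI continuous_on_add continuous_on_mult continuous_on_const
      differentiable_add differentiable_mult differentiable_const) simp_all

lemma multi_derivative_eq_foldr:
  "\<exists>is. \<forall>f. multi_derivative \<alpha> f = foldr partial_derivative is f"
proof -
  have 1: "\<exists>is. \<forall>f. (partial_derivative i ^^ k) f = foldr partial_derivative is f"
    for i :: "'n::finite" and k
    by (rule exI[of _ "replicate k i"]) (induction k; simp)
  have "\<exists>is. \<forall>f. foldr (\<lambda>i. partial_derivative i ^^ \<alpha> i) cs f = foldr partial_derivative is f" for cs
  proof (induction cs)
    case Nil
    then show ?case by (intro exI[of _ "[]"]) simp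
  next
    case (Cons c cs)
    then obtain js where "\<forall>f. foldr (\<lambda>i. partial_derivative i ^^ \<alpha> i) cs f = foldr partial_derivative js f"
      by blast
    moreover obtain ks where "\<forall>f. (partial_derivative c ^^ \<alpha> c) f = foldr partial_derivative ks f"
      using 1 by blast
    ultimately show ?case by (intro exI[of _ "ks @ js"]) simp
  qed
  then show ?thesis by (simp add: multi_derivative_def)
qed

lemma multi_derivative_lincomb:
  assumes "smooth_function f" "smooth_function g"
  shows "multi_derivative \<alpha> (\<lambda>x. a * f x + b * g x) =
         (\<lambda>x. a * multi_derivative \<alpha> f x + b * multi_derivative \<alpha> g x)"
  using multi_derivative_eq_foldr[of \<alpha>] foldr_partial_derivative_lincomb[OF assms] by metis

lemma weight_factor_nonneg: "weight_factor \<omega> m n k x \<ge> 0"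
  by (simp add: weight_factor_def)

lemma O_norm_le_iff:
  "O_norm \<omega> m n f \<le> c \<longleftrightarrow>
     (\<forall>\<alpha> x. ereal (cmod (multi_derivative \<alpha> f x) * weight_factor \<omega> m n (\<Sum>i\<in>UNIV. \<alpha> i) x) \<le> c)"
  by (auto simp: O_norm_def SUP_le_iff)

lemma O_norm_nonneg: "O_norm \<omega> m n f \<ge> 0"
  unfolding O_norm_def by (intro SUP_upper2[OF UNIV_I]) (simp add: weight_factor_nonneg)

lemma O_step_real:
  "f \<in> O_step \<omega> m n \<Longrightarrow> O_norm \<omega> m n f = ereal (real_of_ereal (O_norm \<omega> m n f))"
  using O_norm_nonneg[of \<omega> m n f] by (cases "O_norm \<omega> m n f") (auto simp: O_step_def)

lemma O_norm_lincomb: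
  fixes f g :: "real^'n::finite \<Rightarrow> complex"
  assumes f: "f \<in> O_step \<omega> m n" and g: "g \<in> O_step \<omega> m n"
  shows "O_norm \<omega> m n (\<lambda>x. a * f x + b * g x)
         \<le> ereal (cmod a * real_of_ereal (O_norm \<omega> m n f) + cmod b * real_of_ereal (O_norm \<omega> m n g))"
  unfolding O_norm_le_iff
proof (intro allI)
  fix \<alpha> :: "'n \<Rightarrow> nat" and x :: "real^'n"
  let ?w = "weight_factor \<omega> m n (\<Sum>i\<in>UNIV. \<alpha> i) x"
  have sf: "smooth_function f" "smooth_function g" using f g by (auto simp: O_step_def)
  have bd: "cmod (multi_derivative \<alpha> h x) * ?w \<le> real_of_ereal (O_norm \<omega> m n h)"
    if "h \<in> O_step \<omega> m n" for h :: "real^'n \<Rightarrow> complex"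
  proof -
    have "ereal (cmod (multi_derivative \<alpha> h x) * ?w) \<le> O_norm \<omega> m n h"
      using O_norm_le_iff[of \<omega> m n h "O_norm \<omega> m n h"] by blast
    then show ?thesis by (subst (asm) O_step_real[OF that]) simp
  qed
  have "cmod (a * multi_derivative \<alpha> f x + b * multi_derivative \<alpha> g x) * ?w
      \<le> (cmod a * cmod (multi_derivative \<alpha> f x) + cmod b * cmod (multi_derivative \<alpha> g x)) * ?w"
    by (intro mult_right_mono weight_factor_nonneg) (metis norm_mult norm_triangle_ineq)
  also have "\<dots> = cmod a * (cmod (multi_derivative \<alpha> f x) * ?w) + cmod b * (cmod (multi_derivative \<alpha> g x) * ?w)"
    by (simp add: algebra_simps)
  also have "\<dots> \<le> cmod a * real_of_ereal (O_norm \<omega> m n f) + cmod b * real_of_ereal (O_norm \<omega> m n g)"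
    by (intro add_mono mult_left_mono bd f g norm_ge_zero)
  finally show "ereal (cmod (multi_derivative \<alpha> (\<lambda>x. a * f x + b * g x) x) * ?w)
      \<le> ereal (cmod a * real_of_ereal (O_norm \<omega> m n f) + cmod b * real_of_ereal (O_norm \<omega> m n g))"
    by (simp add: multi_derivative_lincomb[OF sf])
qed

lemma O_step_lincomb:
  assumes f: "f \<in> O_step \<omega> m n" and g: "g \<in> O_step \<omega> m n"
  shows "(\<lambda>x. a * f x + b * g x) \<in> O_step \<omega> m n"
proof -
  have "O_norm \<omega> m n (\<lambda>x. a * f x + b * g x) < \<infinity>"
    using O_norm_lincomb[OF assms, of a b] by (auto intro: le_less_trans)
  then show ?thesis using assms smooth_function_lincomb by (auto simp: O_step_def)
qed

lemma zero_in_O_step: "(\<lambda>_::real^'n::finite. 0) \<in> O_step \<omega> m n"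
proof -
  have pd: "foldr partial_derivative is (\<lambda>_::real^'n. 0) = (\<lambda>_. 0)" for "is"
  proof (induction "is")
    case (Cons i "is")
    then show ?case
      by (simp add: partial_derivative_def fun_eq_iff vector_derivative_at)
  qed simp
  then have "smooth_function (\<lambda>_::real^'n. 0)" by (simp add: smooth_function_def)
  moreover have "multi_derivative \<alpha> (\<lambda>_::real^'n. 0) = (\<lambda>_. 0)" for \<alpha>
    using multi_derivative_eq_foldr[of \<alpha>] pd by metis
  then have "O_norm \<omega> m n (\<lambda>_::real^'n. 0) \<le> 0" by (simp add: O_norm_le_iff)
  then have "O_norm \<omega> m n (\<lambda>_::real^'n. 0) < \<infinity>" by (auto intro: le_less_trans)
  ultimately show ?thesis by (simp add: O_step_def)
qed

lemma openin_O_step_topology: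
  "openin (O_step_topology \<omega> m n) U \<longleftrightarrow> U \<subseteq> O_step \<omega> m n \<and>
     (\<forall>f\<in>U. \<exists>\<epsilon>>0. \<forall>g\<in>O_step \<omega> m n. O_norm \<omega> m n (\<lambda>x. g x - f x) < ereal \<epsilon> \<longrightarrow> g \<in> U)"
  (is "_ \<longleftrightarrow> ?P U")
proof -
  have "istopology ?P"
    unfolding istopology_def
  proof (intro conjI allI impI)
    fix S T assume S: "?P S" and T: "?P T"
    show "S \<inter> T \<subseteq> O_step \<omega> m n" using S by blast
    show "\<forall>f\<in>S \<inter> T. \<exists>\<epsilon>>0. \<forall>g\<in>O_step \<omega> m n. O_norm \<omega> m n (\<lambda>x. g x - f x) < ereal \<epsilon> \<longrightarrow> g \<in> S \<inter> T"
    proof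
      fix f assume f: "f \<in> S \<inter> T"
      obtain d where d: "d > 0" "\<forall>g\<in>O_step \<omega> m n. O_norm \<omega> m n (\<lambda>x. g x - f x) < ereal d \<longrightarrow> g \<in> S"
        using S f by blast
      obtain e where e: "e > 0" "\<forall>g\<in>O_step \<omega> m n. O_norm \<omega> m n (\<lambda>x. g x - f x) < ereal e \<longrightarrow> g \<in> T"
        using T f by blast
      show "\<exists>\<epsilon>>0. \<forall>g\<in>O_step \<omega> m n. O_norm \<omega> m n (\<lambda>x. g x - f x) < ereal \<epsilon> \<longrightarrow> g \<in> S \<inter> T"
      proof (intro exI[of _ "min d e"] conjI ballI impI)
        show "min d e > 0" using d(1) e(1) by simp
        fix g assume g: "g \<in> O_step \<omega> m n" "O_norm \<omega> m n (\<lambda>x. g x - f x) < ereal (min d e)"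
        have "ereal (min d e) \<le> ereal d" "ereal (min d e) \<le> ereal e" by simp_all
        then have "O_norm \<omega> m n (\<lambda>x. g x - f x) < ereal d" "O_norm \<omega> m n (\<lambda>x. g x - f x) < ereal e"
          using less_le_trans[OF g(2)] by blast+
        with d(2) e(2) g(1) show "g \<in> S \<inter> T" by blast
      qed
    qed
  next
    fix \<K> assume "\<forall>K\<in>\<K>. ?P K"
    then show "\<Union>\<K> \<subseteq> O_step \<omega> m n" by blast
  next
    fix \<K> assume K: "\<forall>K\<in>\<K>. ?P K"
    show "\<forall>f\<in>\<Union>\<K>. \<exists>\<epsilon>>0. \<forall>g\<in>O_step \<omega> m n. O_norm \<omega> m n (\<lambda>x. g x - f x) < ereal \<epsilon> \<longrightarrow> g \<in> \<Union>\<K>"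
    proof
      fix f assume "f \<in> \<Union>\<K>"
      then obtain K where "f \<in> K" "K \<in> \<K>" by blast
      with K obtain d where "d > 0" "\<forall>g\<in>O_step \<omega> m n. O_norm \<omega> m n (\<lambda>x. g x - f x) < ereal d \<longrightarrow> g \<in> K"
        by blast
      with \<open>K \<in> \<K>\<close> show "\<exists>\<epsilon>>0. \<forall>g\<in>O_step \<omega> m n. O_norm \<omega> m n (\<lambda>x. g x - f x) < ereal \<epsilon> \<longrightarrow> g \<in> \<Union>\<K>"
        by (intro exI[of _ d]) blast
    qed
  qed
  then show ?thesis unfolding O_step_topology_def by (simp only: topology_inverse')
qed

lemma topspace_O_step_topology [simp]: "topspace (O_step_topology \<omega> m n) = O_step \<omega> m n"
proof
  show "topspace (O_step_topology \<omega> m n) \<subseteq> O_step \<omega> m n"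
    using openin_O_step_topology openin_topspace by blast
  have "openin (O_step_topology \<omega> m n) (O_step \<omega> m n)"
    by (auto simp: openin_O_step_topology intro: exI[of _ 1])
  then show "O_step \<omega> m n \<subseteq> topspace (O_step_topology \<omega> m n)"
    by (rule openin_subset)
qed

lemma topspace_projective_limit:
  "I \<noteq> {} \<Longrightarrow> topspace (projective_limit I T) = (\<Inter>i\<in>I. topspace (T i))"
proof -
  assume "I \<noteq> {}"
  let ?E = "\<Inter>j\<in>I. topspace (T j)"
  have "openin (subtopology (T i) ?E) ?E" if "i \<in> I" for i
    using that by (metis INT_lower inf.absorb_iff2 openin_topspace topspace_subtopology)
  moreover have "U \<subseteq> ?E" if "openin (subtopology (T i) ?E) U" for i U
    using openin_subset[OF that] by simp
  ultimately show ?thesis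
    using \<open>I \<noteq> {}\<close> unfolding projective_limit_def topology_generated_by_topspace by blast
qed

lemma topspace_lc_inductive_limit:
  fixes T :: "'i \<Rightarrow> ('a \<Rightarrow> complex) topology"
  assumes E: "E = (\<Union>i\<in>I. topspace (T i))"
    and zero: "(\<lambda>_. 0) \<in> E"
    and lincomb: "\<And>f g a b. f \<in> E \<Longrightarrow> g \<in> E \<Longrightarrow> (\<lambda>x. a * f x + b * g x) \<in> E"
  shows "topspace (lc_inductive_limit I T) = E"
proof -
  let ?X = "topology_generated_by {E}"
  have opens: "U = {} \<or> U = E" if "openin ?X U" for U
    using openin_topology_generated_by[OF that] by induction auto
  have top: "topspace ?X = E" by simp
  have add: "(\<lambda>x. f x + g x) \<in> E" if "f \<in> E" "g \<in> E" for f g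
    using lincomb[OF that, of 1 1] by simp
  have scale: "(\<lambda>x. c * f x) \<in> E" if "f \<in> E" for f c
    using lincomb[OF that that, of c 0] by simp
  have into: "continuous_map Y ?X F" if "F \<in> topspace Y \<rightarrow> E" for Y :: "'c topology" and F
  proof (rule continuous_on_generated_topo)
    have "F -` E \<inter> topspace Y = topspace Y" using that by auto
    then show "openin Y (F -` U \<inter> topspace Y)" if "U \<in> {E}" for U
      using that by simp
  qed (use that in auto)
  have "locally_convex_topology ?X"
    unfolding locally_convex_topology_def
  proof (intro conjI allI impI)
    show "continuous_map (prod_topology ?X ?X) ?X (\<lambda>(f, g) x. f x + g x)"
      by (rule into) (auto intro: add)
    show "continuous_map (prod_topology euclidean ?X) ?X (\<lambda>(c, f) x. c * f x)"
      by (rule into) (auto intro: scale)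
    fix U assume "openin ?X U \<and> (\<lambda>_. 0) \<in> U"
    then have U: "U = E" "openin ?X E" using opens by auto
    have "(\<lambda>x. complex_of_real (1 - t) * f x + complex_of_real t * g x) \<in> E"
      if "f \<in> E" "g \<in> E" for f g t
      using that by (rule lincomb)
    then show "\<exists>W V. openin ?X W \<and> (\<lambda>_. 0) \<in> W \<and> W \<subseteq> V \<and> V \<subseteq> U \<and>
           (\<forall>f\<in>V. \<forall>g\<in>V. \<forall>t\<in>{0..1}.
              (\<lambda>x. complex_of_real (1 - t) * f x + complex_of_real t * g x) \<in> V)"
      using zero U by (intro exI[of _ E] conjI ballI) simp_all
  qed (use zero in simp)
  moreover have "continuous_map (T i) ?X id" if "i \<in> I" for i
    by (rule into) (use that E in auto)
  ultimately have "?X \<in> {X. locally_convex_topology X \<and> topspace X = (\<Union>i\<in>I. topspace (T i)) \<and>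
                (\<forall>i\<in>I. continuous_map (T i) X id)}" (is "_ \<in> ?C")
    unfolding E[symmetric] by (intro CollectI conjI ballI top)
  moreover have "openin ?X E" by (simp add: topology_generated_by_Basis)
  ultimately have "E \<subseteq> \<Union> (\<Union>X\<in>?C. {U. openin X U})"
    by (intro Union_upper UN_I[of ?X ?C]) (assumption, rule CollectI)
  moreover have "\<Union> (\<Union>X\<in>?C. {U. openin X U}) \<subseteq> E"
  proof (rule Union_least)
    fix U assume "U \<in> (\<Union>X\<in>?C. {U. openin X U})"
    then obtain X where X: "X \<in> ?C" "openin X U" by (rule UN_E) (rule that, assumption, erule CollectD)
    from X(1) have "topspace X = E" unfolding E by simp
    with openin_subset[OF X(2)] show "U \<subseteq> E" by simp
  qed
  ultimately show ?thesis
    unfolding lc_inductive_limit_def topology_generated_by_topspace by (rule subset_antisym[rotated])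
qed

lemma O_step_mono:
  assumes "n \<le> n'" and pos: "\<And>t. t \<ge> 0 \<Longrightarrow> \<omega> t \<ge> 0"
  shows "O_step \<omega> m n \<subseteq> (O_step \<omega> m n' :: (real^'n::finite \<Rightarrow> complex) set)"
proof
  fix f :: "real^'n \<Rightarrow> complex" assume f: "f \<in> O_step \<omega> m n"
  have w: "weight_factor \<omega> m n' k x \<le> weight_factor \<omega> m n k x" for k and x :: "real^'n"
    using assms(1) pos[of "norm x"] by (simp add: weight_factor_def mult_right_mono)
  have "O_norm \<omega> m n' f \<le> O_norm \<omega> m n f"
    unfolding O_norm_def by (intro SUP_mono') (simp add: w mult_left_mono)
  then show "f \<in> O_step \<omega> m n'" using f by (auto simp: O_step_def intro: le_less_trans)
qed

lemma UN_closed_lincomb: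
  fixes A :: "nat \<Rightarrow> ('a \<Rightarrow> complex) set"
  assumes "\<And>n n'. n \<le> n' \<Longrightarrow> A n \<subseteq> A n'"
    and "\<And>n f g. f \<in> A n \<Longrightarrow> g \<in> A n \<Longrightarrow> (\<lambda>x. a * f x + b * g x) \<in> A n"
    and "f \<in> (\<Union>n\<in>{1..}. A n)" "g \<in> (\<Union>n\<in>{1..}. A n)"
  shows "(\<lambda>x. a * f x + b * g x) \<in> (\<Union>n\<in>{1..}. A n)"
proof -
  obtain i j where "i \<ge> 1" "f \<in> A i" "g \<in> A j" using assms(3,4) by auto
  then have "f \<in> A (max i j)" "g \<in> A (max i j)" "max i j \<ge> 1"
    using assms(1)[of i "max i j"] assms(1)[of j "max i j"] by auto
  then show ?thesis using assms(2) by blast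
qed

proposition topspace_O_M:
  assumes "nonquasianalytic_weight \<omega>"
  shows "topspace (O_M \<omega> :: (real^'n::finite \<Rightarrow> complex) topology) = (\<Inter>m\<in>{1..}. \<Union>n\<in>{1..}. O_step \<omega> m n)"
proof -
  have pos: "\<And>t. t \<ge> 0 \<Longrightarrow> \<omega> t \<ge> 0" using assms by (auto simp: nonquasianalytic_weight_def)
  have "topspace (lc_inductive_limit {1..} (O_step_topology \<omega> m)) =
      (\<Union>n\<in>{1..}. O_step \<omega> m n :: (real^'n \<Rightarrow> complex) set)" for m
  proof (intro topspace_lc_inductive_limit)
    show "(\<lambda>_. 0) \<in> (\<Union>n\<in>{1..}. O_step \<omega> m n :: (real^'n \<Rightarrow> complex) set)"
      by (rule UN_I[of 1]) (simp_all add: zero_in_O_step)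
    show "(\<lambda>x. a * f x + b * g x) \<in> (\<Union>n\<in>{1..}. O_step \<omega> m n)"
      if "f \<in> (\<Union>n\<in>{1..}. O_step \<omega> m n)" "g \<in> (\<Union>n\<in>{1..}. O_step \<omega> m n)"
      for f g :: "real^'n \<Rightarrow> complex" and a b
      by (rule UN_closed_lincomb[of "O_step \<omega> m", OF O_step_mono[OF _ pos] O_step_lincomb that])
  qed simp
  then show ?thesis by (simp add: O_M_def topspace_projective_limit)
qed

proposition topspace_O_C:
  assumes "nonquasianalytic_weight \<omega>"
  shows "topspace (O_C \<omega> :: (real^'n::finite \<Rightarrow> complex) topology) = (\<Union>n\<in>{1..}. \<Inter>m\<in>{1..}. O_step \<omega> m n)"
proof -
  have pos: "\<And>t. t \<ge> 0 \<Longrightarrow> \<omega> t \<ge> 0" using assms by (auto simp: nonquasianalytic_weight_def)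
  let ?A = "\<lambda>n. \<Inter>m\<in>{1..}. O_step \<omega> m n :: (real^'n \<Rightarrow> complex) set"
  have mono: "?A n \<subseteq> ?A n'" if "n \<le> n'" for n n'
    by (intro INF_superset_mono subset_refl O_step_mono[OF that pos])
  have lincomb: "(\<lambda>x. a * f x + b * g x) \<in> ?A n" if "f \<in> ?A n" "g \<in> ?A n" for n f g a b
    by (rule INT_I, rule O_step_lincomb) (use that in simp_all)
  show ?thesis
    unfolding O_C_def
  proof (rule topspace_lc_inductive_limit)
    show "(\<Union>n\<in>{1..}. ?A n) =
        (\<Union>n\<in>{1..}. topspace (projective_limit {1..} (\<lambda>m. O_step_topology \<omega> m n)))"
      by (simp add: topspace_projective_limit)
    show "(\<lambda>_. 0) \<in> (\<Union>n\<in>{1..}. ?A n)"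
      by (rule UN_I[of 1]) (simp_all add: zero_in_O_step)
    show "(\<lambda>x. a * f x + b * g x) \<in> (\<Union>n\<in>{1..}. ?A n)"
      if "f \<in> (\<Union>n\<in>{1..}. ?A n)" "g \<in> (\<Union>n\<in>{1..}. ?A n)" for f g a b
      by (rule UN_closed_lincomb[of ?A, OF mono lincomb that])
  qed
qed

end

theory Submission
  imports Defs
begin

text \<open>Evaluating the convolution at \<open>0\<close> gives \<open>T (\<lambda>y. f (- y))\<close>, so joint continuity at \<open>(0, 0)\<close> would
  yield neighbourhoods \<open>V\<close> and \<open>N\<close> of zero on which the duality pairing is bounded by \<open>1\<close>. As \<open>N\<close>
  absorbs every functional, every continuous functional would be bounded on (the reflection of)
  \<open>V\<close>. But \<open>V\<close> is controlled by finitely many norms \<open>r\<^bsub>m,1\<^esub>\<close>, \<open>m \<le> p\<close>, and hence contains a multiple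
  of size about \<open>exp (- p \<omega>(\<xi>))\<close> of the plane wave of frequency \<open>\<xi>\<close>, whereas the functional
  \<open>T f = \<Sum>\<^sub>k (-i/2)\<^sup>k exp (- q \<phi>\<^sup>*(k/q)) \<partial>\<^sub>1\<^sup>k f(0)\<close> is continuous and, by convex duality, has size at least
  \<open>exp (q \<omega>(\<xi>/2)) / (\<xi>/2)\<close> on it. For \<open>q\<close> large compared with \<open>p\<close> these values are unbounded, because
  of the doubling condition and \<open>log (1 + t) = o(\<omega>(t))\<close>.\<close>

section \<open>Inductive and projective limits, strong duals\<close>

definition linear_functional_on :: "('a \<Rightarrow> complex) set \<Rightarrow> (('a \<Rightarrow> complex) \<Rightarrow> complex) \<Rightarrow> bool" where
  "linear_functional_on S L \<longleftrightarrow>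
     (\<forall>f\<in>S. \<forall>g\<in>S. \<forall>a b. L (\<lambda>x. a * f x + b * g x) = a * L f + b * L g)"

definition lincomb_closed :: "('a \<Rightarrow> complex) set \<Rightarrow> bool" where
  "lincomb_closed S \<longleftrightarrow>
     (\<lambda>_. 0) \<in> S \<and> (\<forall>f\<in>S. \<forall>g\<in>S. \<forall>a b. (\<lambda>x. a * f x + b * g x) \<in> S)"

lemma lincomb_closedD:
  assumes "lincomb_closed S"
  shows lincomb_closed_zero: "(\<lambda>_. 0) \<in> S"
    and lincomb_closed_lincomb: "f \<in> S \<Longrightarrow> g \<in> S \<Longrightarrow> (\<lambda>x. a * f x + b * g x) \<in> S"
    and lincomb_closed_add: "f \<in> S \<Longrightarrow> g \<in> S \<Longrightarrow> (\<lambda>x. f x + g x) \<in> S"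
    and lincomb_closed_scale: "f \<in> S \<Longrightarrow> (\<lambda>x. c * f x) \<in> S"
proof -
  show "(\<lambda>_. 0) \<in> S" and *: "\<And>f g a b. f \<in> S \<Longrightarrow> g \<in> S \<Longrightarrow> (\<lambda>x. a * f x + b * g x) \<in> S"
    using assms by (auto simp: lincomb_closed_def)
  show "f \<in> S \<Longrightarrow> g \<in> S \<Longrightarrow> (\<lambda>x. f x + g x) \<in> S" using *[of f g 1 1] by simp
  show "f \<in> S \<Longrightarrow> (\<lambda>x. c * f x) \<in> S" using *[of f f c 0] by simp
qed

lemma linear_functional_onD:
  assumes "linear_functional_on S L"
  shows linear_functional_on_lincomb:
      "f \<in> S \<Longrightarrow> g \<in> S \<Longrightarrow> L (\<lambda>x. a * f x + b * g x) = a * L f + b * L g"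
    and linear_functional_on_add: "f \<in> S \<Longrightarrow> g \<in> S \<Longrightarrow> L (\<lambda>x. f x + g x) = L f + L g"
    and linear_functional_on_diff: "f \<in> S \<Longrightarrow> g \<in> S \<Longrightarrow> L (\<lambda>x. f x - g x) = L f - L g"
    and linear_functional_on_scale: "f \<in> S \<Longrightarrow> L (\<lambda>x. c * f x) = c * L f"
proof -
  show *: "\<And>f g a b. f \<in> S \<Longrightarrow> g \<in> S \<Longrightarrow> L (\<lambda>x. a * f x + b * g x) = a * L f + b * L g"
    using assms by (auto simp: linear_functional_on_def)
  show "f \<in> S \<Longrightarrow> g \<in> S \<Longrightarrow> L (\<lambda>x. f x + g x) = L f + L g" using *[of f g 1 1] by simp
  show "f \<in> S \<Longrightarrow> g \<in> S \<Longrightarrow> L (\<lambda>x. f x - g x) = L f - L g" using *[of f g 1 "-1"] by simp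
  show "f \<in> S \<Longrightarrow> L (\<lambda>x. c * f x) = c * L f" using *[of f f c 0] by simp
qed

lemma linear_functional_on_subset:
  "linear_functional_on S L \<Longrightarrow> S' \<subseteq> S \<Longrightarrow> linear_functional_on S' L"
  by (simp add: linear_functional_on_def subset_iff)

text \<open>The initial topology of a single functional is given by the seminorm |L f|, so preimages
  of balls around 0 are convex neighbourhoods of zero. It serves as one competitor among the
  topologies whose supremum is the inductive limit.\<close>

lemma locally_convex_pullback_topology:
  assumes S: "lincomb_closed S" and L: "linear_functional_on S L"
  shows "locally_convex_topology (pullback_topology S L euclidean)"
proof -
  let ?X = "pullback_topology S L euclidean"
  have top: "topspace ?X = S" by (simp add: topspace_pullback_topology)
  have cL: "continuous_map ?X euclidean L"
    using continuous_map_pullback[of euclidean euclidean id S L] by simp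
  have L0: "L (\<lambda>_. 0) = 0"
    using linear_functional_on_scale[OF L lincomb_closed_zero[OF S], of 0] by simp
  show ?thesis
    unfolding locally_convex_topology_def
  proof (intro conjI allI impI)
    show "(\<lambda>_. 0) \<in> topspace ?X" using lincomb_closed_zero[OF S] top by simp
    show "continuous_map (prod_topology ?X ?X) ?X (\<lambda>(f, g) x. f x + g x)"
    proof (rule continuous_map_pullback')
      have "continuous_map (prod_topology ?X ?X) euclidean (\<lambda>p. L (fst p) + L (snd p))"
        by (intro continuous_map_add
            continuous_map_compose[OF continuous_map_fst cL, unfolded o_def]
            continuous_map_compose[OF continuous_map_snd cL, unfolded o_def])
      then show "continuous_map (prod_topology ?X ?X) euclidean (L \<circ> (\<lambda>(f, g) x. f x + g x))"
        by (rule continuous_map_eq) (auto simp: top linear_functional_on_add[OF L])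
      show "topspace (prod_topology ?X ?X) \<subseteq> (\<lambda>(f, g) x. f x + g x) -` S"
        by (auto simp: top lincomb_closed_add[OF S])
    qed
    show "continuous_map (prod_topology euclidean ?X) ?X (\<lambda>(c, f) x. c * f x)"
    proof (rule continuous_map_pullback')
      have 1: "continuous_map (prod_topology euclidean ?X) euclidean (\<lambda>p. L (snd p))"
        by (rule continuous_map_compose[OF continuous_map_snd cL, unfolded o_def])
      have 2: "continuous_map (prod_topology euclidean ?X) euclidean fst"
        by (rule continuous_map_fst)
      have "continuous_map (prod_topology euclidean ?X) euclidean (\<lambda>p. fst p * L (snd p))"
        using 1 2 by (auto simp: continuous_map_atin intro!: tendsto_mult)
      then show "continuous_map (prod_topology euclidean ?X) euclidean (L \<circ> (\<lambda>(c, f) x. c * f x))"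
        by (rule continuous_map_eq) (auto simp: top linear_functional_on_scale[OF L])
      show "topspace (prod_topology euclidean ?X) \<subseteq> (\<lambda>(c, f) x. c * f x) -` S"
        by (auto simp: top lincomb_closed_scale[OF S])
    qed
    fix U assume "openin ?X U \<and> (\<lambda>_. 0) \<in> U"
    then obtain W where W: "open W" "U = L -` W \<inter> S" "0 \<in> W"
      using L0 by (auto simp: openin_pullback_topology)
    then obtain e where e: "e > 0" "ball 0 e \<subseteq> W" using openE by blast
    let ?V = "L -` ball 0 e \<inter> S"
    have "(\<lambda>x. complex_of_real (1 - t) * f x + complex_of_real t * g x) \<in> ?V"
      if f: "f \<in> ?V" and g: "g \<in> ?V" and t: "t \<in> {0..1}" for f g t
    proof -
      have "(1 - t) *\<^sub>R L f + t *\<^sub>R L g \<in> ball 0 e"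
        by (rule convexD[OF convex_ball]) (use that in auto)
      then show ?thesis
        using f g by (simp add: linear_functional_on_lincomb[OF L] lincomb_closed_lincomb[OF S]
            scaleR_conv_of_real)
    qed
    moreover have "openin ?X ?V" by (auto simp: openin_pullback_topology)
    moreover have "(\<lambda>_. 0) \<in> ?V" using L0 lincomb_closed_zero[OF S] e by simp
    moreover have "?V \<subseteq> U" using W e by auto
    ultimately show "\<exists>W V. openin ?X W \<and> (\<lambda>_. 0) \<in> W \<and> W \<subseteq> V \<and> V \<subseteq> U \<and>
        (\<forall>f\<in>V. \<forall>g\<in>V. \<forall>t\<in>{0..1}.
           (\<lambda>x. complex_of_real (1 - t) * f x + complex_of_real t * g x) \<in> V)"
      by (intro exI[of _ ?V] conjI ballI) auto
  qed
qed

section \<open>Continuity and open sets in the limit topologies\<close>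

lemma topspace_lc_inductive_limit':
  assumes "lincomb_closed (\<Union>i\<in>I. topspace (T i))"
  shows "topspace (lc_inductive_limit I T) = (\<Union>i\<in>I. topspace (T i))"
  using assms by (intro topspace_lc_inductive_limit lincomb_closed_lincomb lincomb_closed_zero) auto

text \<open>Universal property for functionals: continuity of \<open>L\<close> on every step puts
  the pullback topology of \<open>L\<close> among the topologies generating the limit, so preimages
  of open sets under \<open>L\<close> are subbasic open sets.\<close>

lemma continuous_map_lc_inductive_limit:
  assumes S: "lincomb_closed (\<Union>i\<in>I. topspace (T i))"
    and L: "linear_functional_on (\<Union>i\<in>I. topspace (T i)) L"
    and cont: "\<And>i. i \<in> I \<Longrightarrow> continuous_map (T i) euclidean L"
  shows "continuous_map (lc_inductive_limit I T) euclidean L"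
proof -
  let ?S = "\<Union>i\<in>I. topspace (T i)"
  let ?X = "pullback_topology ?S L euclidean"
  have "continuous_map (T i) ?X id" if "i \<in> I" for i
    using cont[OF that] that by (intro continuous_map_pullback') auto
  moreover have "topspace ?X = ?S" by (simp add: topspace_pullback_topology)
  ultimately have X: "?X \<in> {X. locally_convex_topology X \<and> topspace X = ?S \<and>
      (\<forall>i\<in>I. continuous_map (T i) X id)}" (is "_ \<in> ?C")
    using locally_convex_pullback_topology[OF S L] by blast
  show ?thesis
    unfolding continuous_map_def
  proof (intro conjI allI impI)
    fix U :: "complex set" assume "openin euclidean U"
    then have "openin ?X (L -` U \<inter> ?S)" by (auto simp: openin_pullback_topology)
    then have "openin (lc_inductive_limit I T) (L -` U \<inter> ?S)"
      unfolding lc_inductive_limit_def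
      by (intro topology_generated_by_Basis UN_I[OF X]) (rule CollectI)
    moreover have "{x \<in> topspace (lc_inductive_limit I T). L x \<in> U} = L -` U \<inter> ?S"
      unfolding topspace_lc_inductive_limit'[OF S] by blast
    ultimately show "openin (lc_inductive_limit I T) {x \<in> topspace (lc_inductive_limit I T). L x \<in> U}"
      by simp
  qed simp
qed

text \<open>Continuity of the inclusion of a step. It holds on generators by their definition, and
  taking traces commutes with finite intersections and unions.\<close>

lemma openin_lc_inductive_limit_step:
  assumes i: "i \<in> I" and U: "openin (lc_inductive_limit I T) U"
  shows "openin (T i) (U \<inter> topspace (T i))"
proof -
  have "generate_topology_on (\<Union>X\<in>{X. locally_convex_topology X \<and>
      topspace X = (\<Union>i\<in>I. topspace (T i)) \<and> (\<forall>i\<in>I. continuous_map (T i) X id)}. {U. openin X U}) U"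
    using U unfolding lc_inductive_limit_def by (rule openin_topology_generated_by)
  then show ?thesis
  proof induction
    case (Int a b)
    then have "openin (T i) ((a \<inter> topspace (T i)) \<inter> (b \<inter> topspace (T i)))" by blast
    moreover have "(a \<inter> topspace (T i)) \<inter> (b \<inter> topspace (T i)) = a \<inter> b \<inter> topspace (T i)" by blast
    ultimately show ?case by simp
  next
    case (UN K)
    then have "openin (T i) (\<Union>k\<in>K. k \<inter> topspace (T i))" by blast
    then show ?case by (simp add: Int_commute Int_Union)
  next
    case (Basis s)
    then obtain X where "continuous_map (T i) X id" "openin X s" using i by blast
    then have "openin (T i) {x \<in> topspace (T i). id x \<in> s}"
      by (rule openin_continuous_map_preimage)
    moreover have "{x \<in> topspace (T i). id x \<in> s} = s \<inter> topspace (T i)" by auto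
    ultimately show ?case by simp
  qed simp
qed

lemma continuous_map_projective_limit:
  assumes j: "j \<in> I" and cont: "continuous_map (T j) Y L"
  shows "continuous_map (projective_limit I T) Y L"
  unfolding continuous_map_def
proof (intro conjI allI impI)
  let ?E = "\<Inter>i\<in>I. topspace (T i)"
  have top: "topspace (projective_limit I T) = ?E"
    using j by (intro topspace_projective_limit) auto
  show "L \<in> topspace (projective_limit I T) \<rightarrow> topspace Y"
    using cont j unfolding top continuous_map_def by auto
  fix U assume "openin Y U"
  then have "openin (subtopology (T j) ?E) ({x \<in> topspace (T j). L x \<in> U} \<inter> ?E)"
    using cont openin_subtopology_Int by (fastforce simp: continuous_map_def)
  moreover have "{x \<in> topspace (T j). L x \<in> U} \<inter> ?E = {x \<in> ?E. L x \<in> U}" using j by auto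
  ultimately have "openin (subtopology (T j) ?E) {x \<in> ?E. L x \<in> U}" by simp
  then show "openin (projective_limit I T) {x \<in> topspace (projective_limit I T). L x \<in> U}"
    unfolding top unfolding projective_limit_def
    by (intro topology_generated_by_Basis UN_I[OF j]) (rule CollectI)
qed

lemma continuous_map_O_step_topology:
  assumes L: "linear_functional_on (O_step \<omega> m n) L"
    and bd: "\<And>f. f \<in> O_step \<omega> m n \<Longrightarrow> ereal (cmod (L f)) \<le> ereal C * O_norm \<omega> m n f"
    and C: "C > 0"
  shows "continuous_map (O_step_topology \<omega> m n) euclidean L"
  unfolding continuous_map_def
proof (intro conjI allI impI)
  fix U :: "complex set" assume "openin euclidean U"
  then have U: "open U" by simp
  show "openin (O_step_topology \<omega> m n) {x \<in> topspace (O_step_topology \<omega> m n). L x \<in> U}"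
    unfolding openin_O_step_topology topspace_O_step_topology
  proof (intro conjI ballI)
    fix f assume f: "f \<in> {x \<in> O_step \<omega> m n. L x \<in> U}"
    then obtain e where e: "e > 0" "ball (L f) e \<subseteq> U" using U openE by blast
    show "\<exists>\<epsilon>>0. \<forall>g\<in>O_step \<omega> m n. O_norm \<omega> m n (\<lambda>x. g x - f x) < ereal \<epsilon> \<longrightarrow>
        g \<in> {x \<in> O_step \<omega> m n. L x \<in> U}"
    proof (intro exI[of _ "e / C"] conjI ballI impI)
      fix g assume g: "g \<in> O_step \<omega> m n" "O_norm \<omega> m n (\<lambda>x. g x - f x) < ereal (e / C)"
      have "(\<lambda>x. g x - f x) \<in> O_step \<omega> m n"
        using O_step_lincomb[of g \<omega> m n f 1 "-1"] f g by simp
      note bd[OF this]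
      also have "ereal C * O_norm \<omega> m n (\<lambda>x. g x - f x) < ereal e"
        using g(2) C O_norm_nonneg[of \<omega> m n "\<lambda>x. g x - f x"]
        by (cases "O_norm \<omega> m n (\<lambda>x. g x - f x)") (auto simp: field_simps)
      finally have "cmod (L g - L f) < e"
        using linear_functional_on_diff[OF L] f g by simp
      then show "g \<in> {x \<in> O_step \<omega> m n. L x \<in> U}"
        using e g(1) by (auto simp: dist_norm norm_minus_commute subset_iff)
    qed (use e C in simp)
  qed auto
qed simp

text \<open>Reduces membership in an open set to finitely many levels: a generator involves one
  index, an intersection merges two finite index sets, and a union inherits the data of one
  member.\<close>

lemma openin_projective_limit_nhd:
  assumes U: "openin (projective_limit I T) U" and x: "x \<in> U"
  shows "\<exists>F W. finite F \<and> F \<subseteq> I \<and> (\<forall>i\<in>F. openin (T i) (W i) \<and> x \<in> W i) \<and>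
    (\<forall>y\<in>\<Inter>i\<in>I. topspace (T i). (\<forall>i\<in>F. y \<in> W i) \<longrightarrow> y \<in> U)"
proof -
  let ?E = "\<Inter>i\<in>I. topspace (T i)"
  have "generate_topology_on (\<Union>i\<in>I. {U. openin (subtopology (T i) ?E) U}) U"
    using U unfolding projective_limit_def by (rule openin_topology_generated_by)
  then show ?thesis
    using x
  proof induction
    case (Int a b)
    obtain F V where F: "finite F" "F \<subseteq> I" "\<forall>i\<in>F. openin (T i) (V i) \<and> x \<in> V i"
      "\<forall>y\<in>?E. (\<forall>i\<in>F. y \<in> V i) \<longrightarrow> y \<in> a"
      using Int by blast
    obtain G W where G: "finite G" "G \<subseteq> I" "\<forall>i\<in>G. openin (T i) (W i) \<and> x \<in> W i"
      "\<forall>y\<in>?E. (\<forall>i\<in>G. y \<in> W i) \<longrightarrow> y \<in> b"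
      using Int by blast
    \<comment> \<open>An index occurring in only one of the two finite sets gets the whole space as
      its other factor.\<close>
    let ?W = "\<lambda>i. (if i \<in> F then V i else topspace (T i)) \<inter> (if i \<in> G then W i else topspace (T i))"
    have "openin (T i) (?W i) \<and> x \<in> ?W i" if "i \<in> F \<union> G" for i
      using that F(3) G(3) openin_subset by fastforce
    moreover have "y \<in> a \<inter> b" if "y \<in> ?E" "\<forall>i\<in>F \<union> G. y \<in> ?W i" for y
    proof -
      have "\<forall>i\<in>F. y \<in> V i" "\<forall>i\<in>G. y \<in> W i" using that(2) by (metis IntD1 IntD2 UnI1 UnI2)+
      then show ?thesis using F(4) G(4) that(1) by blast
    qed
    ultimately show ?case
      using F(1,2) G(1,2) by (intro exI[of _ "F \<union> G"] exI[of _ ?W] conjI) auto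
  next
    case (UN K)
    then obtain k where k: "k \<in> K" "x \<in> k" by blast
    from UN.IH[OF k] obtain F W where "finite F" "F \<subseteq> I" "\<forall>i\<in>F. openin (T i) (W i) \<and> x \<in> W i"
      "\<forall>y\<in>?E. (\<forall>i\<in>F. y \<in> W i) \<longrightarrow> y \<in> k"
      by blast
    then show ?case using k by (intro exI[of _ F] exI[of _ W]) blast
  next
    case (Basis s)
    then obtain i W where i: "i \<in> I" "openin (T i) W" "s = W \<inter> ?E"
      by (auto simp: openin_subtopology)
    then show ?case using Basis by (intro exI[of _ "{i}"] exI[of _ "\<lambda>_. W"]) auto
  qed simp
qed

section \<open>Boundedness and absorption in the strong dual\<close>

text \<open>The set where |T f| < 1 is a neighbourhood of zero, so some multiple of it contains
  \<open>B\<close>.\<close>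

lemma continuous_dual_bounded:
  assumes T: "T \<in> continuous_dual X" and B: "bounded_subset X B" and 0: "(\<lambda>_. 0) \<in> topspace X"
  shows "\<exists>r>0. \<forall>f\<in>B. cmod (T f) \<le> r"
proof -
  have cont: "continuous_map X euclidean T"
    and scale: "\<And>c f. f \<in> topspace X \<Longrightarrow> T (\<lambda>x. c * f x) = c * T f"
    using T by (auto simp: continuous_dual_def)
  let ?U = "{f \<in> topspace X. T f \<in> ball 0 1}"
  have "openin X ?U" using openin_continuous_map_preimage[OF cont, of "ball 0 1"] by simp
  moreover have "(\<lambda>_. 0) \<in> ?U" using 0 scale[OF 0, of 0] by simp
  ultimately obtain r where r: "r > 0" "B \<subseteq> (\<lambda>g x. complex_of_real r * g x) ` ?U"
    using B unfolding bounded_subset_def by blast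
  have "cmod (T f) \<le> r" if f: "f \<in> B" for f
  proof -
    obtain g where g: "f = (\<lambda>x. complex_of_real r * g x)" "g \<in> ?U" using r f by auto
    have "cmod (T f) = r * cmod (T g)" using g r scale by (simp add: norm_mult)
    also have "\<dots> \<le> r * 1" using g r by (intro mult_left_mono) auto
    finally show ?thesis by simp
  qed
  then show ?thesis using r by blast
qed

text \<open>A subbasic ball around \<open>T0\<close> that contains zero does so with some slack, and
  a small multiple of \<open>T\<close> is uniformly small on the bounded set. All \<open>c\<close>
  up to a threshold are demanded so that intersections can take the smaller threshold.\<close>

lemma strong_dual_absorbing:
  assumes N: "openin (strong_dual X) N" and zero: "restrict (\<lambda>_. 0) (topspace X) \<in> N"
    and T: "T \<in> continuous_dual X" and X: "lincomb_closed (topspace X)"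
  shows "\<exists>c0>0. \<forall>c. 0 < c \<and> c \<le> c0 \<longrightarrow> restrict (\<lambda>f. complex_of_real c * T f) (topspace X) \<in> N"
proof -
  let ?cT = "\<lambda>c. restrict (\<lambda>f. complex_of_real c * T f) (topspace X)"
  have "generate_topology_on
     {{S \<in> continuous_dual X. (SUP f\<in>B. ereal (cmod (S f - T f))) < ereal \<epsilon>} | B T \<epsilon>.
          bounded_subset X B \<and> T \<in> continuous_dual X \<and> \<epsilon> > 0} N"
    using N unfolding strong_dual_def by (rule openin_topology_generated_by)
  then show ?thesis
    using zero
  proof induction
    case (Int a b)
    then obtain c d where "c > 0" "d > 0" "\<forall>x. 0 < x \<and> x \<le> c \<longrightarrow> ?cT x \<in> a"
      "\<forall>x. 0 < x \<and> x \<le> d \<longrightarrow> ?cT x \<in> b"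
      by blast
    then have "\<forall>x. 0 < x \<and> x \<le> min c d \<longrightarrow> ?cT x \<in> a \<inter> b" "min c d > 0"
      unfolding min.bounded_iff min_less_iff_conj by blast+
    then show ?case by blast
  next
    case (UN K)
    then obtain k where k: "k \<in> K" "restrict (\<lambda>_. 0) (topspace X) \<in> k" by blast
    from UN.IH[OF k] obtain c where "c > 0" "\<forall>x. 0 < x \<and> x \<le> c \<longrightarrow> ?cT x \<in> k" by blast
    then show ?case using k by blast
  next
    case (Basis s)
    then obtain B T0 \<epsilon> where s: "s = {S \<in> continuous_dual X. (SUP f\<in>B. ereal (cmod (S f - T0 f))) < ereal \<epsilon>}"
      and B: "bounded_subset X B" and e: "\<epsilon> > 0"
      by blast
    have sub: "B \<subseteq> topspace X" using B by (simp add: bounded_subset_def)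
    obtain r where r: "r > 0" "\<forall>f\<in>B. cmod (T f) \<le> r"
      using continuous_dual_bounded[OF T B lincomb_closed_zero[OF X]] by blast
    have "(SUP f\<in>B. ereal (cmod (restrict (\<lambda>_. 0) (topspace X) f - T0 f))) < ereal \<epsilon>"
      using Basis s by blast
    \<comment> \<open>A value strictly between the supremum and \<epsilon> measures the slack. For
      empty \<open>B\<close> the supremum is -\<infinity> and \<open>q'\<close> may be negative, so
      \<open>q\<close> is cut off at 0.\<close>
    then obtain q' where q': "(SUP f\<in>B. ereal (cmod (restrict (\<lambda>_. 0) (topspace X) f - T0 f))) < q'" "q' < ereal \<epsilon>"
      using dense by blast
    define q where "q = max 0 (real_of_ereal q')"
    have q: "q < \<epsilon>" using q'(2) e by (cases q') (auto simp: q_def)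
    have T0: "cmod (T0 f) \<le> q" if "f \<in> B" for f
    proof -
      have "ereal (cmod (restrict (\<lambda>_. 0) (topspace X) f - T0 f)) < q'"
        using q'(1) SUP_upper[OF that] by (rule le_less_trans[rotated])
      then show ?thesis using that sub q'(2) by (cases q') (auto simp: q_def)
    qed
    \<comment> \<open>Half of the slack is spent: \<open>c * r\<close> is at most (\<epsilon> - q) /
      2, which leaves the bound (\<epsilon> + q) / 2 < \<epsilon>.\<close>
    let ?c0 = "(\<epsilon> - q) / (2 * r)"
    have "?cT c \<in> s" if c: "0 < c" "c \<le> ?c0" for c
    proof -
      have "continuous_map X euclidean (\<lambda>f. complex_of_real c * T f)"
        using T by (auto simp: continuous_dual_def continuous_map_atin intro: tendsto_mult)
      then have "continuous_map X euclidean (?cT c)" by (rule continuous_map_eq) auto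
      then have dual: "?cT c \<in> continuous_dual X"
        using T lincomb_closed_add[OF X] lincomb_closed_scale[OF X]
        by (auto simp: continuous_dual_def algebra_simps)
      have "cmod (?cT c f - T0 f) \<le> (\<epsilon> + q) / 2" if f: "f \<in> B" for f
      proof -
        have "cmod (?cT c f - T0 f) \<le> c * cmod (T f) + cmod (T0 f)"
          using f sub c norm_triangle_ineq4[of "complex_of_real c * T f" "T0 f"]
          by (auto simp: norm_mult)
        also have "\<dots> \<le> ?c0 * r + q"
          using c r f T0[OF f] by (intro add_mono mult_mono) auto
        also have "\<dots> = (\<epsilon> + q) / 2" using r(1) by (simp add: field_simps)
        finally show ?thesis .
      qed
      then have "(SUP f\<in>B. ereal (cmod (?cT c f - T0 f))) \<le> ereal ((\<epsilon> + q) / 2)"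
        by (intro SUP_least) simp
      also have "\<dots> < ereal \<epsilon>" using q by simp
      finally show ?thesis using dual s by blast
    qed
    moreover have "?c0 > 0" using q r(1) by simp
    ultimately show ?case by blast
  qed simp
qed

section \<open>Plane waves and an infinite-order functional\<close>

text \<open>The frequency vector is (\<xi>, ..., \<xi>), so every coordinate derivative multiplies
  by the same factor i\<xi> and mixed derivatives depend only on their order.\<close>

definition plane_wave :: "real \<Rightarrow> real^'n::finite \<Rightarrow> complex" where
  "plane_wave \<xi> x = exp (\<i> * complex_of_real (\<xi> * (\<Sum>j\<in>UNIV. x $ j)))"

lemma norm_plane_wave [simp]: "norm (plane_wave \<xi> x) = 1"
  by (simp add: plane_wave_def)

lemma plane_wave_zero [simp]: "plane_wave \<xi> 0 = 1"
  by (simp add: plane_wave_def)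

lemma plane_wave_uminus: "plane_wave \<xi> (- x) = plane_wave (- \<xi>) x"
  by (simp add: plane_wave_def sum_negf)

text \<open>The scalar \<open>c\<close> is carried along so that iterated derivatives stay within
  the same family.\<close>

lemma has_vector_derivative_plane_wave:
  "((\<lambda>t. c * plane_wave \<xi> (x + t *\<^sub>R axis i 1)) has_vector_derivative
     (\<i> * complex_of_real \<xi>) * c * plane_wave \<xi> x) (at 0)"
proof -
  have "(\<Sum>j\<in>UNIV. (x + t *\<^sub>R axis i 1) $ j) = (\<Sum>j\<in>UNIV. x $ j) + t" for t
    by (simp add: sum.distrib axis_def if_distrib[of "(*) t"] cong: if_cong)
  then have eq: "c * plane_wave \<xi> (x + t *\<^sub>R axis i 1) =
      c * plane_wave \<xi> x * exp (t *\<^sub>R (\<i> * complex_of_real \<xi>))" for t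
    by (simp add: plane_wave_def exp_add[symmetric] scaleR_conv_of_real algebra_simps)
  have "((\<lambda>t. exp (t *\<^sub>R (\<i> * complex_of_real \<xi>))) has_vector_derivative
      exp (0 *\<^sub>R (\<i> * complex_of_real \<xi>)) * (\<i> * complex_of_real \<xi>)) (at 0)"
    by (rule exp_scaleR_has_vector_derivative_right)
  from has_vector_derivative_mult_right[OF this, of "c * plane_wave \<xi> x"]
  show ?thesis unfolding eq by (simp add: mult_ac)
qed

lemma partial_derivative_plane_wave:
  "partial_derivative i (\<lambda>x. c * plane_wave \<xi> x) =
     (\<lambda>x. (\<i> * complex_of_real \<xi>) * c * plane_wave \<xi> x)"
  unfolding partial_derivative_def
  by (intro ext vector_derivative_at has_vector_derivative_plane_wave)

lemma foldr_partial_derivative_plane_wave: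
  "foldr partial_derivative is (\<lambda>x. c * plane_wave \<xi> x) =
     (\<lambda>x. (\<i> * complex_of_real \<xi>) ^ length is * c * plane_wave \<xi> x)"
  by (induction "is") (simp_all add: partial_derivative_plane_wave mult.assoc[symmetric])

lemma smooth_function_plane_wave: "smooth_function (\<lambda>x. c * plane_wave \<xi> x)"
  unfolding smooth_function_def foldr_partial_derivative_plane_wave
proof (intro allI conjI)
  fix "is" :: "'a list" and i :: 'a and x :: "real^'a"
  show "continuous_on UNIV (\<lambda>x. (\<i> * complex_of_real \<xi>) ^ length is * c * plane_wave \<xi> x)"
    unfolding plane_wave_def by (intro continuous_intros)
  show "(\<lambda>t. (\<i> * complex_of_real \<xi>) ^ length is * c * plane_wave \<xi> (x + t *\<^sub>R axis i 1))
      differentiable at 0"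
    using has_vector_derivative_plane_wave by (rule differentiableI_vector)
qed

lemma set_coordinates: "set (coordinates :: 'n::finite list) = UNIV"
  and distinct_coordinates: "distinct (coordinates :: 'n list)"
proof -
  have "\<exists>is :: 'n list. set is = UNIV \<and> distinct is" using finite_distinct_list[OF finite] by blast
  then have "set (coordinates :: 'n list) = UNIV \<and> distinct (coordinates :: 'n list)"
    unfolding coordinates_def by (rule someI_ex)
  then show "set (coordinates :: 'n list) = UNIV" "distinct (coordinates :: 'n list)" by auto
qed

lemma multi_derivative_plane_wave:
  "multi_derivative \<alpha> (\<lambda>x. c * plane_wave \<xi> x) =
     (\<lambda>x. (\<i> * complex_of_real \<xi>) ^ (\<Sum>i\<in>UNIV. \<alpha> i) * c * plane_wave \<xi> x)"
proof -
  have pow: "(partial_derivative i ^^ k) (\<lambda>x. d * plane_wave \<xi> x) =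
      (\<lambda>x. (\<i> * complex_of_real \<xi>) ^ k * d * plane_wave \<xi> x)" for i :: 'a and k d
    by (induction k) (simp_all add: partial_derivative_plane_wave mult.assoc[symmetric])
  have "foldr (\<lambda>i. partial_derivative i ^^ \<alpha> i) cs (\<lambda>x. c * plane_wave \<xi> x) =
      (\<lambda>x. (\<i> * complex_of_real \<xi>) ^ sum_list (map \<alpha> cs) * c * plane_wave \<xi> x)" for cs
    by (induction cs) (simp_all add: pow power_add mult.assoc[symmetric])
  then show ?thesis
    by (simp add: multi_derivative_def sum_list_distinct_conv_sum_set set_coordinates distinct_coordinates)
qed

lemma multi_derivative_zero: "multi_derivative (\<lambda>_. 0) f = f"
proof -
  have "foldr (\<lambda>i. partial_derivative i ^^ 0) cs f = f" for cs :: "'a list"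
    by (induction cs) simp_all
  then show ?thesis by (simp add: multi_derivative_def)
qed

section \<open>Convex duality between the weight and its Young conjugate\<close>

text \<open>The supremum defining the conjugate is tested at t = ln \<xi>, which is admissible
  because \<xi> \<ge> 1. An infinite conjugate makes the factor 0.\<close>

lemma power_mult_weight_factor_le:
  assumes pos: "\<And>t. t \<ge> 0 \<Longrightarrow> \<omega> t \<ge> 0" and m: "m \<ge> 1" and "\<xi> \<ge> 1"
  shows "\<xi> ^ k * weight_factor \<omega> m n k x \<le> exp (real m * \<omega> \<xi>)"
proof (cases "young_conjugate \<omega> (real k / real m) = \<infinity>")
  case True
  then show ?thesis by (simp add: weight_factor_def)
next
  case False
  have "ereal (real k / real m * ln \<xi> - \<omega> (exp (ln \<xi>))) \<le> young_conjugate \<omega> (real k / real m)"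
    unfolding young_conjugate_def using assms by (intro SUP_upper) auto
  then obtain y where y: "young_conjugate \<omega> (real k / real m) = ereal y"
    "real k / real m * ln \<xi> - \<omega> \<xi> \<le> y"
    using False assms by (cases "young_conjugate \<omega> (real k / real m)") auto
  have "real m * (real k / real m * ln \<xi> - \<omega> \<xi>) \<le> real m * y"
    using y by (intro mult_left_mono) auto
  then have "real k * ln \<xi> - real m * \<omega> \<xi> \<le> real m * y" using m by (simp add: algebra_simps)
  moreover have "\<xi> ^ k = exp (real k * ln \<xi>)" using assms by (simp add: exp_of_nat_mult)
  moreover have "real n * \<omega> (norm x) \<ge> 0" using pos by simp
  ultimately show ?thesis by (simp add: weight_factor_def y flip: exp_add)
qed

text \<open>A supporting line at \<open>u\<close>; its slope is the dual variable that gives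
  equality in Young's inequality at \<open>u\<close>.\<close>

lemma subgradient_exists:
  fixes \<phi> :: "real \<Rightarrow> real"
  assumes "convex_on UNIV \<phi>"
  obtains s where "\<And>v. \<phi> v \<ge> \<phi> u + s * (v - u)"
  using convex_le_Inf_differential[OF assms, of u] by auto

text \<open>The case \<open>\<phi>\<^sup>*\<^sup>* = \<phi>\<close> of convex duality, with the dual variable restricted to multiples of
  \<open>1/m\<close>; rounding down costs the factor \<open>\<mu>\<close>.\<close>

lemma power_mult_weight_factor_ge:
  assumes w: "nonquasianalytic_weight \<omega>" and m: "m \<ge> 1" and \<mu>: "\<mu> \<ge> 1"
  shows "\<exists>k. exp (real m * \<omega> \<mu>) / \<mu> \<le> \<mu> ^ k * weight_factor \<omega> m n k 0"
proof -
  define u where "u = ln \<mu>"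
  have u: "u \<ge> 0" "exp u = \<mu>" using \<mu> by (auto simp: u_def)
  obtain s where s: "\<And>v. \<omega> (exp v) \<ge> \<omega> \<mu> + s * (v - u)"
    using subgradient_exists[of "\<lambda>t. \<omega> (exp t)" u] w u by (auto simp: nonquasianalytic_weight_def)
  \<comment> \<open>Monotonicity one unit to the left forces a nonnegative slope, so that the floor
    below yields a natural number k \<le> m s.\<close>
  have "\<omega> (exp (u - 1)) \<le> \<omega> (exp u)"
    using w by (auto simp: nonquasianalytic_weight_def mono_on_def)
  with s[of "u - 1"] u have s0: "s \<ge> 0" by simp
  define k where "k = nat \<lfloor>real m * s\<rfloor>"
  have k: "real k \<le> real m * s" "real m * s \<le> real k + 1"
    using s0 by (auto simp: k_def)
  have km: "real k / real m \<le> s" using k m by (simp add: field_simps)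
  \<comment> \<open>The supporting line bounds every competitor v \<ge> 0. Hence the conjugate is
    not +\<infinity> and \<open>weight_factor\<close> does not take its default value 0.\<close>
  have le: "young_conjugate \<omega> (real k / real m) \<le> ereal (s * u - \<omega> \<mu>)"
    unfolding young_conjugate_def
  proof (rule SUP_least)
    fix v :: real assume "v \<in> {0..}"
    then have "real k / real m * v \<le> s * v" using km by (intro mult_right_mono) auto
    then show "ereal (real k / real m * v - \<omega> (exp v)) \<le> ereal (s * u - \<omega> \<mu>)"
      using s[of v] by (simp add: algebra_simps)
  qed
  \<comment> \<open>The competitor t = 0 rules out the value -\<infinity>.\<close>
  have "ereal (real k / real m * 0 - \<omega> (exp 0)) \<le> young_conjugate \<omega> (real k / real m)"
    unfolding young_conjugate_def by (intro SUP_upper) auto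
  with le obtain y where y: "young_conjugate \<omega> (real k / real m) = ereal y" "y \<le> s * u - \<omega> \<mu>"
    by (cases "young_conjugate \<omega> (real k / real m)") auto
  \<comment> \<open>Rounding m s down to k loses at most u = ln \<mu>, which becomes the divisor
    \<mu>.\<close>
  have "real m * s * u \<le> (real k + 1) * u" using k u by (intro mult_right_mono) auto
  moreover have "real m * y \<le> real m * (s * u - \<omega> \<mu>)" using y by (intro mult_left_mono) auto
  ultimately have "real m * \<omega> \<mu> - u \<le> real k * u - real m * y" by (simp add: algebra_simps)
  then have "exp (real m * \<omega> \<mu>) / exp u \<le> exp (real k * u) * exp (- (real m * y))"
    by (simp flip: exp_diff exp_add)
  moreover have "\<omega> 0 = 0" using w by (auto simp: nonquasianalytic_weight_def)
  moreover have "\<mu> ^ k = exp (real k * u)" using u by (simp add: exp_of_nat_mult)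
  ultimately show ?thesis using u by (intro exI[of _ k]) (simp add: weight_factor_def y)
qed

text \<open>A derivative of order k has constant modulus |c| |\<xi>|^k, so
  \<open>power_mult_weight_factor_le\<close> bounds all orders and points at once, with the same
  bound for every \<open>n\<close>.\<close>

lemma O_norm_plane_wave_le:
  assumes pos: "\<And>t. t \<ge> 0 \<Longrightarrow> \<omega> t \<ge> 0" and m: "m \<ge> 1" and \<xi>: "\<bar>\<xi>\<bar> \<ge> 1"
  shows "O_norm \<omega> m n (\<lambda>x::real^'n::finite. c * plane_wave \<xi> x)
     \<le> ereal (cmod c * exp (real m * \<omega> \<bar>\<xi>\<bar>))"
  unfolding O_norm_le_iff multi_derivative_plane_wave
proof (intro allI)
  fix \<alpha> :: "'n \<Rightarrow> nat" and x :: "real^'n"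
  let ?k = "\<Sum>i\<in>UNIV. \<alpha> i"
  have "cmod c * (\<bar>\<xi>\<bar> ^ ?k * weight_factor \<omega> m n ?k x) \<le> cmod c * exp (real m * \<omega> \<bar>\<xi>\<bar>)"
    by (intro mult_left_mono power_mult_weight_factor_le pos m \<xi>) auto
  then show "ereal (cmod ((\<i> * complex_of_real \<xi>) ^ ?k * c * plane_wave \<xi> x) * weight_factor \<omega> m n ?k x)
      \<le> ereal (cmod c * exp (real m * \<omega> \<bar>\<xi>\<bar>))"
    by (simp add: norm_mult norm_power mult_ac)
qed

lemma plane_wave_in_O_step:
  assumes "\<And>t. t \<ge> 0 \<Longrightarrow> \<omega> t \<ge> 0" "m \<ge> 1" "\<bar>\<xi>\<bar> \<ge> 1"
  shows "(\<lambda>x::real^'n::finite. c * plane_wave \<xi> x) \<in> O_step \<omega> m n"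
proof -
  have "O_norm \<omega> m n (\<lambda>x::real^'n. c * plane_wave \<xi> x) < \<infinity>"
    by (rule le_less_trans[OF O_norm_plane_wave_le[where \<omega> = \<omega> and n = n and c = c, OF assms]]) simp_all
  then show ?thesis using smooth_function_plane_wave by (simp add: O_step_def)
qed

section \<open>The functional built from the jet at the origin\<close>

definition axis_derivative :: "'n::finite \<Rightarrow> nat \<Rightarrow> (real^'n \<Rightarrow> complex) \<Rightarrow> complex" where
  "axis_derivative i k f = multi_derivative (\<lambda>j. if j = i then k else 0) f 0"

text \<open>The powers of \<open>-\<i>\<close> make all terms of the series positive on \<^term>\<open>plane_wave \<xi>\<close>, \<open>\<xi> > 0\<close>.\<close>

definition jet_term :: "(real \<Rightarrow> real) \<Rightarrow> nat \<Rightarrow> 'n::finite \<Rightarrow> (real^'n \<Rightarrow> complex) \<Rightarrow> nat \<Rightarrow> complex" where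
  "jet_term \<omega> m i f k =
     (- \<i>) ^ k * complex_of_real ((1/2) ^ k * weight_factor \<omega> m 0 k (0::real^'n)) * axis_derivative i k f"

text \<open>An infinite-order differential operator with constant coefficients, evaluated at the
  origin. For \<omega> 0 = 0 the series converges absolutely on every
  \<open>O_step \<omega> m n\<close>.\<close>

definition jet_functional :: "(real \<Rightarrow> real) \<Rightarrow> nat \<Rightarrow> 'n::finite \<Rightarrow> (real^'n \<Rightarrow> complex) \<Rightarrow> complex" where
  "jet_functional \<omega> m i f = (\<Sum>k. jet_term \<omega> m i f k)"

text \<open>Growth in x is invisible at the origin. This is why coefficients defined with n = 0 are
  controlled by the norms for all \<open>n\<close>.\<close>

lemma weight_factor_at_zero:
  "\<omega> 0 = 0 \<Longrightarrow> weight_factor \<omega> m n k (0::'a::real_normed_vector) = weight_factor \<omega> m 0 k (0::'a)"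
  by (simp add: weight_factor_def)

text \<open>The multi-index concentrated at \<open>i\<close> and the point 0 give one instance of
  the supremum in \<open>O_norm\<close>. Its weight is the one in \<open>jet_term\<close>, and the
  remaining (1/2)^k secures convergence.\<close>

lemma norm_jet_term_le:
  fixes f :: "real^'n::finite \<Rightarrow> complex"
  assumes "\<omega> 0 = 0" "f \<in> O_step \<omega> m n"
  shows "norm (jet_term \<omega> m i f k) \<le> real_of_ereal (O_norm \<omega> m n f) * (1/2) ^ k"
proof -
  let ?\<alpha> = "\<lambda>j. if j = i then k else 0"
  have "ereal (cmod (multi_derivative ?\<alpha> f 0) * weight_factor \<omega> m n (\<Sum>j\<in>UNIV. ?\<alpha> j) (0::real^'n))
      \<le> O_norm \<omega> m n f"
    using O_norm_le_iff[of \<omega> m n f "O_norm \<omega> m n f"] by blast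
  then have "cmod (axis_derivative i k f) * weight_factor \<omega> m n k (0::real^'n)
      \<le> real_of_ereal (O_norm \<omega> m n f)"
    unfolding axis_derivative_def[symmetric] using O_step_real[OF assms(2)] by (cases "O_norm \<omega> m n f") simp_all
  then have "(1/2) ^ k * (cmod (axis_derivative i k f) * weight_factor \<omega> m 0 k (0::real^'n))
      \<le> (1/2) ^ k * real_of_ereal (O_norm \<omega> m n f)"
    using weight_factor_at_zero[where 'a="real^'n" and \<omega> = \<omega> and m = m and n = n and k = k, OF assms(1)] by (intro mult_left_mono) simp_all
  then show ?thesis
    by (simp add: jet_term_def norm_mult norm_power weight_factor_nonneg mult_ac)
qed

lemma summable_norm_jet_term:
  assumes "\<omega> 0 = 0" "f \<in> O_step \<omega> m n"
  shows "summable (\<lambda>k. norm (jet_term \<omega> m i f k))"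
  by (rule summable_comparison_test'[where N = 0 and g = "\<lambda>k. real_of_ereal (O_norm \<omega> m n f) * (1/2) ^ k"])
    (use norm_jet_term_le[of \<omega>, OF assms] in \<open>auto intro!: summable_mult summable_geometric\<close>)

text \<open>Summing the geometric majorant gives the constant 2. It is the same for all
  \<open>n\<close>, the form in which \<open>cont\<close> of
  \<open>discontinuous_convolution\<close> takes its bound.\<close>

lemma norm_jet_functional_le:
  assumes "\<omega> 0 = 0" "f \<in> O_step \<omega> m n"
  shows "ereal (cmod (jet_functional \<omega> m i f)) \<le> ereal 2 * O_norm \<omega> m n f"
proof -
  let ?r = "real_of_ereal (O_norm \<omega> m n f)"
  have "cmod (jet_functional \<omega> m i f) \<le> (\<Sum>k. norm (jet_term \<omega> m i f k))"
    unfolding jet_functional_def by (rule summable_norm[OF summable_norm_jet_term[of \<omega>, OF assms]])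
  also have "\<dots> \<le> (\<Sum>k. ?r * (1/2) ^ k)"
    by (intro suminf_le norm_jet_term_le[of \<omega>, OF assms] summable_norm_jet_term[of \<omega>, OF assms] summable_mult
        summable_geometric) auto
  also have "\<dots> = 2 * ?r"
    by (subst suminf_mult) (auto intro!: summable_geometric simp: suminf_geometric)
  finally have "ereal (cmod (jet_functional \<omega> m i f)) \<le> ereal 2 * ereal ?r" by simp
  then show ?thesis using O_step_real[OF assms(2)] by simp
qed

text \<open>The two functions may come from different steps; absolute convergence on each of them
  lets the series be added termwise.\<close>

lemma linear_functional_on_jet_functional:
  fixes i :: "'n::finite"
  assumes "\<omega> 0 = 0"
  shows "linear_functional_on (\<Union>n\<in>N. O_step \<omega> m n) (jet_functional \<omega> m i)"
  unfolding linear_functional_on_def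
proof (intro ballI allI)
  fix f g :: "real^'n \<Rightarrow> complex" and a b
  assume "f \<in> (\<Union>n\<in>N. O_step \<omega> m n)" "g \<in> (\<Union>n\<in>N. O_step \<omega> m n)"
  then obtain p q where f: "f \<in> O_step \<omega> m p" and g: "g \<in> O_step \<omega> m q" by blast
  have sm: "smooth_function f" "smooth_function g" using f g by (auto simp: O_step_def)
  have 1: "summable (jet_term \<omega> m i f)" "summable (jet_term \<omega> m i g)"
    using f g by (auto intro: summable_norm_cancel summable_norm_jet_term[of \<omega>, OF assms])
  have "jet_term \<omega> m i (\<lambda>x. a * f x + b * g x) = (\<lambda>k. a * jet_term \<omega> m i f k + b * jet_term \<omega> m i g k)"
    by (simp add: fun_eq_iff jet_term_def axis_derivative_def multi_derivative_lincomb[OF sm] algebra_simps)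
  then show "jet_functional \<omega> m i (\<lambda>x. a * f x + b * g x)
      = a * jet_functional \<omega> m i f + b * jet_functional \<omega> m i g"
    unfolding jet_functional_def using 1 by (simp add: suminf_add[symmetric] suminf_mult summable_mult)
qed

text \<open>At frequency 2\<mu> the factor -i/2 turns 2i\<mu> into \<mu>, so all terms are
  nonnegative. The sum is then at least the single large term supplied by
  \<open>power_mult_weight_factor_ge\<close>.\<close>

lemma jet_functional_plane_wave_ge:
  fixes i :: "'n::finite"
  assumes w: "nonquasianalytic_weight \<omega>" and m: "m \<ge> 1" and \<mu>: "\<mu> \<ge> 1"
  shows "cmod (jet_functional \<omega> m i (plane_wave (2 * \<mu>))) \<ge> exp (real m * \<omega> \<mu>) / \<mu>"
proof -
  have pos: "\<And>t. t \<ge> 0 \<Longrightarrow> \<omega> t \<ge> 0" and 0: "\<omega> 0 = 0"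
    using w by (auto simp: nonquasianalytic_weight_def)
  let ?a = "\<lambda>k. \<mu> ^ k * weight_factor \<omega> m 0 k (0::real^'n)"
  have mem: "(plane_wave (2 * \<mu>) :: real^'n \<Rightarrow> complex) \<in> O_step \<omega> m 0"
    using plane_wave_in_O_step[where \<omega> = \<omega> and \<xi> = "2 * \<mu>" and c = 1 and n = 0 and 'n = 'n, OF pos m] \<mu> by simp
  have a: "jet_term \<omega> m i (plane_wave (2 * \<mu>)) k = complex_of_real (?a k)" for k
  proof -
    have "axis_derivative i k (plane_wave (2 * \<mu>)) = (\<i> * complex_of_real (2 * \<mu>)) ^ k"
      using multi_derivative_plane_wave[of "\<lambda>j. if j = i then k else 0" 1 "2 * \<mu>"]
      by (simp add: axis_derivative_def)
    then have "jet_term \<omega> m i (plane_wave (2 * \<mu>)) k =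
        ((- \<i>) * (1/2) * (\<i> * complex_of_real (2 * \<mu>))) ^ k * complex_of_real (weight_factor \<omega> m 0 k (0::real^'n))"
      unfolding jet_term_def power_mult_distrib by (simp add: mult_ac)
    then show ?thesis by (simp add: mult_ac)
  qed
  have nonneg: "?a k \<ge> 0" for k using \<mu> by (simp add: weight_factor_nonneg)
  have summ: "summable ?a"
    using summable_norm_jet_term[of \<omega>, OF 0 mem, where i = i]
    by (simp only: a norm_of_real abs_of_nonneg[OF nonneg])
  obtain k where k: "exp (real m * \<omega> \<mu>) / \<mu> \<le> ?a k"
    using power_mult_weight_factor_ge[OF w m \<mu>] by blast
  also have "?a k \<le> suminf ?a"
    using sum_le_suminf[OF summ, of "{k}"] nonneg by simp
  also have "\<dots> \<le> cmod (complex_of_real (suminf ?a))" by simp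
  also have "complex_of_real (suminf ?a) = jet_functional \<omega> m i (plane_wave (2 * \<mu>))"
    unfolding jet_functional_def a by (rule suminf_of_real[OF summ])
  finally show ?thesis .
qed

text \<open>The instance of order 0 at the origin has weight 1: the conjugate vanishes at 0 because
  \<omega> is nonnegative and \<omega> 1 = 0. It yields continuity of evaluation at the
  origin.\<close>

lemma norm_at_zero_le_O_norm:
  fixes f :: "real^'n::finite \<Rightarrow> complex"
  assumes w: "nonquasianalytic_weight \<omega>"
  shows "ereal (cmod (f 0)) \<le> O_norm \<omega> m n f"
proof -
  have "\<omega> (exp t) \<ge> 0" for t using w by (simp add: nonquasianalytic_weight_def)
  moreover have *: "\<omega> 0 = 0" "\<omega> 1 = 0" using w by (auto simp: nonquasianalytic_weight_def)
  ultimately have "young_conjugate \<omega> 0 = 0"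
    unfolding young_conjugate_def
    by (intro antisym SUP_least SUP_upper2[of 0]) (auto simp: zero_ereal_def)
  then have "weight_factor \<omega> m n 0 (0::real^'n) = 1" using * by (simp add: weight_factor_def)
  moreover have "ereal (cmod (multi_derivative (\<lambda>_. 0) f 0) * weight_factor \<omega> m n (\<Sum>i\<in>(UNIV::'n set). 0) (0::real^'n))
      \<le> O_norm \<omega> m n f"
    using O_norm_le_iff[of \<omega> m n f "O_norm \<omega> m n f"] by blast
  ultimately show ?thesis by (simp add: multi_derivative_zero)
qed

section \<open>Unboundedness of the duality pairing\<close>

text \<open>The little-o relation with constant 1 puts \<omega> above ln (1 + t) eventually; a point
  beyond exp A then satisfies both bounds.\<close>

lemma weight_dominates_ln:
  fixes \<omega> :: "real \<Rightarrow> real"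
  assumes "(\<lambda>t. ln (1 + t)) \<in> o[at_top](\<omega>)" and pos: "\<And>t. t \<ge> 0 \<Longrightarrow> \<omega> t \<ge> 0"
  shows "\<exists>\<mu>\<ge>1. \<mu> \<le> exp (\<omega> \<mu>) \<and> A \<le> \<omega> \<mu>"
proof -
  have "eventually (\<lambda>t. norm (ln (1 + t)) \<le> 1 * norm (\<omega> t)) at_top"
    using landau_o.smallD[OF assms(1), of 1] by simp
  moreover have "eventually (\<lambda>t. t \<ge> max 1 (exp A)) at_top" by (rule eventually_ge_at_top)
  ultimately have "eventually (\<lambda>t. norm (ln (1 + t)) \<le> 1 * norm (\<omega> t) \<and> t \<ge> max 1 (exp A)) at_top"
    by eventually_elim simp
  then obtain t where t: "norm (ln (1 + t)) \<le> 1 * norm (\<omega> t)" "t \<ge> max 1 (exp A)"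
    using eventually_happens trivial_limit_at_top_linorder by blast
  have "ln t \<le> ln (1 + t)" using t by simp
  moreover have "ln (1 + t) \<le> \<omega> t" using t pos[of t] by simp
  ultimately have "ln t \<le> \<omega> t" by linarith
  then have "t \<le> exp (\<omega> t)" using t by (metis exp_le_cancel_iff exp_ln less_le_trans zero_less_one max.bounded_iff)
  moreover have "A \<le> ln t" using t by (metis exp_gt_zero ln_exp ln_mono max.bounded_iff less_le_trans)
  ultimately show ?thesis using t \<open>ln t \<le> \<omega> t\<close> by (intro exI[of _ t]) auto
qed

text \<open>To be read with w = \<omega>(\<mu>) and W = \<omega>(2\<mu>). Of the exponent q w, the
  part p K w pays for the doubling, one w absorbs A + p K and another w absorbs the divisor
  \<mu>.\<close>

lemma exponential_gap:
  fixes A K w W \<mu> :: real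
  assumes "W \<le> K * (1 + w)" "p * K + 2 \<le> q" "p \<ge> 0" "w \<ge> 0" "0 < \<mu>" "\<mu> \<le> exp w" "A + p * K \<le> w"
  shows "exp A * exp (p * W) \<le> exp (q * w) / \<mu>"
proof -
  have "p * W \<le> p * (K * (1 + w))" using assms by (intro mult_left_mono)
  moreover have "(p * K + 2) * w \<le> q * w" using assms by (intro mult_right_mono)
  ultimately have "A + p * W + w \<le> q * w" using assms(7) by (simp add: algebra_simps)
  then have "exp A * exp (p * W) * exp w \<le> exp (q * w)" by (simp flip: exp_add)
  moreover have "exp A * exp (p * W) * \<mu> \<le> exp A * exp (p * W) * exp w"
    using assms by (intro mult_left_mono) auto
  ultimately have "exp A * exp (p * W) * \<mu> \<le> exp (q * w)" by linarith
  then show ?thesis using \<open>0 < \<mu>\<close> by (simp add: pos_le_divide_eq)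
qed

text \<open>The two spaces differ in the order of their limits, and the assumptions on
  \<open>E\<close> isolate what they share. Plane waves belong to \<open>E\<close> through n = 1
  (\<open>sup\<close>), functionals bounded uniformly in \<open>n\<close> at one level
  \<open>m\<close> are continuous (\<open>cont\<close>), and on the part n = 1 finitely many norms
  decide about neighbourhoods of zero (\<open>nhd\<close>).\<close>

lemma discontinuous_convolution:
  fixes E :: "(real^'n::finite \<Rightarrow> complex) topology"
  assumes w: "nonquasianalytic_weight \<omega>" and o: "(\<lambda>t. ln (1 + t)) \<in> o[at_top](\<omega>)"
    and closed: "lincomb_closed (topspace E)"
    and sup: "(\<Inter>m\<in>{1..}. O_step \<omega> m 1) \<subseteq> topspace E"
    and sub: "\<And>m. m \<ge> 1 \<Longrightarrow> topspace E \<subseteq> (\<Union>n\<in>{1..}. O_step \<omega> m n)"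
    and cont: "\<And>m C L. m \<ge> 1 \<Longrightarrow> C > 0 \<Longrightarrow> linear_functional_on (\<Union>n\<in>{1..}. O_step \<omega> m n) L \<Longrightarrow>
        (\<And>n f. f \<in> O_step \<omega> m n \<Longrightarrow> ereal (cmod (L f)) \<le> ereal C * O_norm \<omega> m n f) \<Longrightarrow>
        continuous_map E euclidean L"
    and nhd: "\<And>V. openin E V \<Longrightarrow> (\<lambda>_. 0) \<in> V \<Longrightarrow>
        \<exists>F \<epsilon>. finite F \<and> F \<subseteq> {1..} \<and> \<epsilon> > 0 \<and>
          (\<forall>f\<in>\<Inter>m\<in>{1..}. O_step \<omega> m 1. (\<forall>m\<in>F. O_norm \<omega> m 1 f < ereal \<epsilon>) \<longrightarrow> f \<in> V)"
  shows "discontinuous_map (prod_topology E (strong_dual E)) E (\<lambda>(f, T). convolution T f)"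
  unfolding discontinuous_map_def
proof (intro exI conjI notI)
  have pos: "\<And>t. t \<ge> 0 \<Longrightarrow> \<omega> t \<ge> 0" and \<omega>0: "\<omega> 0 = 0"
    using w by (auto simp: nonquasianalytic_weight_def)
  \<comment> \<open>Continuity of evaluation at the origin makes |g 0| < 1 an open condition; its
    preimage will turn out to contain no product neighbourhood of (0, 0).\<close>
  have "continuous_map E euclidean (\<lambda>f. f 0)"
    by (rule cont[of 1 1])
      (use norm_at_zero_le_O_norm[OF w] in \<open>auto simp: linear_functional_on_def one_ereal_def[symmetric]\<close>)
  from openin_continuous_map_preimage[OF this, of "ball 0 1"]
  show "openin E {g \<in> topspace E. cmod (g 0) < 1}" (is "openin E ?U") by simp
  let ?P = "prod_topology E (strong_dual E)" and ?Z = "restrict (\<lambda>_. 0) (topspace E)"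
  assume "openin ?P {p \<in> topspace ?P. (case p of (f, T) \<Rightarrow> convolution T f) \<in> ?U}" (is "openin ?P ?W")
  have zero: "(\<lambda>_. 0) \<in> topspace E" by (rule lincomb_closed_zero[OF closed])
  have zero_dual: "?Z \<in> continuous_dual E"
  proof -
    have "continuous_map E euclidean ?Z"
      by (rule continuous_map_eq[of E euclidean "\<lambda>_. 0"]) auto
    then show ?thesis
      using lincomb_closed_add[OF closed] lincomb_closed_scale[OF closed]
      by (auto simp: continuous_dual_def)
  qed
  \<comment> \<open>Over the empty bounded set the supremum is -\<infinity>, so this subbasic set is
    the whole dual. It places the zero functional in
    \<open>topspace (strong_dual E)\<close>.\<close>
  have "openin (strong_dual E) {S \<in> continuous_dual E. (SUP f\<in>{}. ereal (cmod (S f - ?Z f))) < ereal 1}"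
    unfolding strong_dual_def using zero_dual
    by (intro topology_generated_by_Basis CollectI exI[of _ "{}"] exI[of _ ?Z] exI[of _ 1] conjI)
      (auto simp: bounded_subset_def intro!: exI[of _ 1])
  then have "?Z \<in> topspace (strong_dual E)"
    using openin_subset zero_dual by (fastforce simp: bot_ereal_def)
  moreover have "convolution ?Z (\<lambda>_. 0) = (\<lambda>_. 0)"
    using zero by (simp add: convolution_def fun_eq_iff)
  ultimately have "((\<lambda>_. 0), ?Z) \<in> ?W" using zero by simp
  from openin_prod_topology_alt[THEN iffD1, rule_format, OF \<open>openin ?P ?W\<close> this]
  obtain V N where V: "openin E V" "(\<lambda>_. 0) \<in> V"
    and N: "openin (strong_dual E) N" "?Z \<in> N" and VN: "V \<times> N \<subseteq> ?W"
    by blast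
  obtain F \<epsilon> where F: "finite F" "F \<subseteq> {1..}" and \<epsilon>: "\<epsilon> > 0"
    and FV: "\<And>f. f \<in> (\<Inter>m\<in>{1..}. O_step \<omega> m 1) \<Longrightarrow> (\<forall>m\<in>F. O_norm \<omega> m 1 f < ereal \<epsilon>) \<Longrightarrow> f \<in> V"
    using nhd[OF V] by blast
  obtain p where p: "\<And>m. m \<in> F \<Longrightarrow> m \<le> p"
    using F(1) by (meson finite_nat_set_iff_bounded_le)
  obtain K where K: "K \<ge> 1" "\<And>t. t \<ge> 0 \<Longrightarrow> \<omega> (2 * t) \<le> K * (1 + \<omega> t)"
    using w by (auto simp: nonquasianalytic_weight_def)
  \<comment> \<open>The wave has frequency 2\<mu>, while the functional is only known to reach exp
    (q \<omega>(\<mu>)) / \<mu> on it. The summand p K pays for the doubling and 2 for the constants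
    and the divisor.\<close>
  define q where "q = nat \<lceil>real p * K + 2\<rceil>"
  have q: "real p * K + 2 \<le> real q" unfolding q_def by (rule real_nat_ceiling_ge)
  have q1: "q \<ge> 1" using q K mult_nonneg_nonneg[of "real p" K] by linarith
  \<comment> \<open>Any coordinate works, as \<open>plane_wave\<close> treats all of them
    alike.\<close>
  define i :: 'n where "i = undefined"
  define T where "T = restrict (jet_functional \<omega> q i) (topspace E)"
  have lin: "linear_functional_on (topspace E) (jet_functional \<omega> q i)"
    by (rule linear_functional_on_subset[OF linear_functional_on_jet_functional[of \<omega>, OF \<omega>0] sub[OF q1]])
  have "continuous_map E euclidean (jet_functional \<omega> q i)"
    by (rule cont[OF q1, of 2])
      (use linear_functional_on_jet_functional[where \<omega> = \<omega> and N = "{1..}" and m = q and i = i, OF \<omega>0]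
        norm_jet_functional_le[of \<omega>, OF \<omega>0] in auto)
  then have "continuous_map E euclidean T"
    by (rule continuous_map_eq) (auto simp: T_def)
  then have T: "T \<in> continuous_dual E"
    using lincomb_closed_add[OF closed] lincomb_closed_scale[OF closed]
    by (auto simp: continuous_dual_def T_def linear_functional_on_add[OF lin] linear_functional_on_scale[OF lin])
  obtain c where c: "c > 0" and "restrict (\<lambda>f. complex_of_real c * T f) (topspace E) \<in> N"
    using strong_dual_absorbing[OF N T closed] by (metis order_refl)
  moreover define cT where "cT = restrict (\<lambda>f. complex_of_real c * T f) (topspace E)"
  ultimately have cN: "cT \<in> N" by simp
  \<comment> \<open>The frequency is chosen after \<open>c\<close> and \<epsilon>; the constant 2 /
    (c \<epsilon>) offsets the scalings by \<open>c\<close> and by \<open>d\<close> below.\<close>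
  obtain \<mu> where \<mu>: "\<mu> \<ge> 1" "\<mu> \<le> exp (\<omega> \<mu>)" "ln (2 / (c * \<epsilon>)) + real p * K \<le> \<omega> \<mu>"
    using weight_dominates_ln[OF o pos, of "ln (2 / (c * \<epsilon>)) + real p * K"] by blast
  have gap: "exp (ln (2 / (c * \<epsilon>))) * exp (real p * \<omega> (2 * \<mu>)) \<le> exp (real q * \<omega> \<mu>) / \<mu>"
    by (rule exponential_gap[OF K(2) q]) (use \<mu> pos[of \<mu>] in auto)
  \<comment> \<open>This amplitude makes the norms of \<open>f\<close> of index m \<le> p at most
    \<epsilon> / 2.\<close>
  define d where "d = \<epsilon> / (2 * exp (real p * \<omega> (2 * \<mu>)))"
  have d: "d > 0" using \<epsilon> by (simp add: d_def)
  \<comment> \<open>The negative frequency undoes the reflection in the convolution at 0.\<close>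
  define f where "f = (\<lambda>x::real^'n. complex_of_real d * plane_wave (- (2 * \<mu>)) x)"
  have mem: "(\<lambda>x. b * plane_wave \<xi> x) \<in> topspace E" if "\<bar>\<xi>\<bar> \<ge> 1" for b \<xi>
    using sup that by (auto intro!: plane_wave_in_O_step pos)
  have "f \<in> V"
  proof (rule FV)
    show "f \<in> (\<Inter>m\<in>{1..}. O_step \<omega> m 1)"
      using \<mu> by (auto simp: f_def intro!: plane_wave_in_O_step pos)
    show "\<forall>m\<in>F. O_norm \<omega> m 1 f < ereal \<epsilon>"
    proof
      fix m assume m: "m \<in> F"
      have "O_norm \<omega> m 1 f \<le> ereal (cmod (complex_of_real d) * exp (real m * \<omega> \<bar>- (2 * \<mu>)\<bar>))"
        unfolding f_def using m F(2) \<mu> by (intro O_norm_plane_wave_le pos) auto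
      also have "\<dots> \<le> ereal (d * exp (real p * \<omega> (2 * \<mu>)))"
        using p[OF m] d \<mu> pos[of "2 * \<mu>"] by (auto intro!: mult_left_mono mult_right_mono)
      also have "\<dots> < ereal \<epsilon>" using \<epsilon> by (simp add: d_def)
      finally show "O_norm \<omega> m 1 f < ereal \<epsilon>" .
    qed
  qed
  then have "(f, cT) \<in> ?W" using cN VN by blast
  then have "cmod (convolution cT f 0) < 1" by simp
  moreover have "convolution cT f 0
      = complex_of_real (c * d) * jet_functional \<omega> q i (plane_wave (2 * \<mu>))"
  proof -
    have "(\<lambda>y. f (0 - y)) = (\<lambda>y. complex_of_real d * plane_wave (2 * \<mu>) y)"
      by (simp add: f_def plane_wave_uminus)
    moreover have "plane_wave (2 * \<mu>) \<in> topspace E" using mem[of "2 * \<mu>" 1] \<mu> by simp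
    ultimately show ?thesis
      using mem[of "2 * \<mu>" "complex_of_real d"] \<mu> linear_functional_on_scale[OF lin]
      by (simp add: convolution_def cT_def T_def)
  qed
  moreover have "1 \<le> c * d * (exp (real q * \<omega> \<mu>) / \<mu>)"
  proof -
    have "1 = c * d * (2 / (c * \<epsilon>) * exp (real p * \<omega> (2 * \<mu>)))" using c \<epsilon> by (simp add: d_def)
    also have "\<dots> \<le> c * d * (exp (real q * \<omega> \<mu>) / \<mu>)"
      using gap c d \<epsilon> by (intro mult_left_mono) auto
    finally show ?thesis .
  qed
  moreover have "c * d * (exp (real q * \<omega> \<mu>) / \<mu>)
      \<le> c * d * cmod (jet_functional \<omega> q i (plane_wave (2 * \<mu>)))"
    using c d by (intro mult_left_mono jet_functional_plane_wave_ge[OF w q1 \<mu>(1)]) auto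
  ultimately show False using c d by (simp add: norm_mult)
qed

section \<open>Verification of the criterion for the two spaces\<close>

lemma lincomb_closed_UN_O_step:
  assumes "nonquasianalytic_weight \<omega>"
  shows "lincomb_closed (\<Union>n\<in>{1..}. O_step \<omega> m n :: (real^'n::finite \<Rightarrow> complex) set)"
  unfolding lincomb_closed_def
proof (intro conjI ballI allI)
  have pos: "\<And>t. t \<ge> 0 \<Longrightarrow> \<omega> t \<ge> 0" using assms by (auto simp: nonquasianalytic_weight_def)
  show "(\<lambda>_. 0) \<in> (\<Union>n\<in>{1..}. O_step \<omega> m n :: (real^'n \<Rightarrow> complex) set)"
    by (rule UN_I[of 1]) (simp_all add: zero_in_O_step)
  fix f g :: "real^'n \<Rightarrow> complex" and a b
  assume fg: "f \<in> (\<Union>n\<in>{1..}. O_step \<omega> m n)" "g \<in> (\<Union>n\<in>{1..}. O_step \<omega> m n)"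
  show "(\<lambda>x. a * f x + b * g x) \<in> (\<Union>n\<in>{1..}. O_step \<omega> m n)"
    by (rule UN_closed_lincomb[of "O_step \<omega> m", OF O_step_mono[OF _ pos] O_step_lincomb fg])
qed

lemma lincomb_closed_UN_INT_O_step:
  assumes "nonquasianalytic_weight \<omega>"
  shows "lincomb_closed (\<Union>n\<in>{1..}. \<Inter>m\<in>{1..}. O_step \<omega> m n :: (real^'n::finite \<Rightarrow> complex) set)"
  unfolding lincomb_closed_def
proof (intro conjI ballI allI)
  have pos: "\<And>t. t \<ge> 0 \<Longrightarrow> \<omega> t \<ge> 0" using assms by (auto simp: nonquasianalytic_weight_def)
  let ?A = "\<lambda>n. \<Inter>m\<in>{1..}. O_step \<omega> m n :: (real^'n \<Rightarrow> complex) set"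
  show "(\<lambda>_. 0) \<in> (\<Union>n\<in>{1..}. ?A n)"
    by (rule UN_I[of 1]) (simp_all add: zero_in_O_step)
  have mono: "?A n \<subseteq> ?A n'" if "n \<le> n'" for n n'
    by (intro INF_superset_mono subset_refl O_step_mono[OF that pos])
  have lincomb: "(\<lambda>x. a * f x + b * g x) \<in> ?A n" if "f \<in> ?A n" "g \<in> ?A n" for n f g a b
    by (rule INT_I, rule O_step_lincomb) (use that in simp_all)
  fix f g and a b
  assume fg: "f \<in> (\<Union>n\<in>{1..}. ?A n)" "g \<in> (\<Union>n\<in>{1..}. ?A n)"
  show "(\<lambda>x. a * f x + b * g x) \<in> (\<Union>n\<in>{1..}. ?A n)"
    by (rule UN_closed_lincomb[of ?A, OF mono lincomb fg])
qed

lemma lincomb_closed_INT: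
  "(\<And>i. i \<in> I \<Longrightarrow> lincomb_closed (S i)) \<Longrightarrow> lincomb_closed (\<Inter>i\<in>I. S i)"
  by (simp add: lincomb_closed_def)

lemma openin_O_step_topology_nhd_zero:
  assumes "openin (O_step_topology \<omega> m n) W" "(\<lambda>_. 0) \<in> W"
  shows "\<exists>\<epsilon>>0. \<forall>f\<in>O_step \<omega> m n. O_norm \<omega> m n f < ereal \<epsilon> \<longrightarrow> f \<in> W"
  using bspec[OF conjunct2[OF iffD1[OF openin_O_step_topology assms(1)]] assms(2)] by simp

lemma finite_common_radius:
  fixes P :: "'i \<Rightarrow> real \<Rightarrow> bool"
  assumes "finite F" "\<And>i. i \<in> F \<Longrightarrow> \<exists>\<epsilon>>0. P i \<epsilon>" "\<And>i \<epsilon> \<delta>. P i \<epsilon> \<Longrightarrow> \<delta> \<le> \<epsilon> \<Longrightarrow> P i \<delta>"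
  shows "\<exists>\<epsilon>>0. \<forall>i\<in>F. P i \<epsilon>"
  using assms(1,2)
proof (induction F)
  case empty
  then show ?case by (auto intro: exI[of _ 1])
next
  case (insert x F)
  then obtain e where e: "e > 0" "\<forall>i\<in>F. P i e" by blast
  obtain d where d: "d > 0" "P x d" using insert.prems by blast
  have "P i (min d e)" if "i \<in> insert x F" for i
    using that d(2) e(2) assms(3)[of i d "min d e"] assms(3)[of i e "min d e"] by auto
  then show ?case using d(1) e(1) by (intro exI[of _ "min d e"]) simp
qed

text \<open>Serves both orders of limits: \<open>T m\<close> is an inductive limit over
  \<open>n\<close> in one case and the normed step itself in the other. As the normed step maps
  continuously into \<open>T m\<close>, each of the finitely many open sets contains a norm ball,
  and the least radius works for all.\<close>

lemma projective_limit_nhd_zero: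
  fixes T :: "nat \<Rightarrow> (real^'n::finite \<Rightarrow> complex) topology"
  assumes V: "openin (projective_limit {1..} T) V" "(\<lambda>_. 0) \<in> V"
    and step: "\<And>m W. m \<ge> 1 \<Longrightarrow> openin (T m) W \<Longrightarrow> openin (O_step_topology \<omega> m n) (W \<inter> O_step \<omega> m n)"
    and sub: "\<And>m. m \<ge> 1 \<Longrightarrow> O_step \<omega> m n \<subseteq> topspace (T m)"
  shows "\<exists>F \<epsilon>. finite F \<and> F \<subseteq> {1..} \<and> \<epsilon> > 0 \<and>
    (\<forall>f\<in>\<Inter>m\<in>{1..}. O_step \<omega> m n. (\<forall>m\<in>F. O_norm \<omega> m n f < ereal \<epsilon>) \<longrightarrow> f \<in> V)"
proof -
  obtain F W where F: "finite F" "F \<subseteq> {1..}"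
    and W: "\<forall>m\<in>F. openin (T m) (W m) \<and> (\<lambda>_. 0) \<in> W m"
    and WV: "\<forall>f\<in>\<Inter>m\<in>{1..}. topspace (T m). (\<forall>m\<in>F. f \<in> W m) \<longrightarrow> f \<in> V"
    using openin_projective_limit_nhd[OF V] by (elim exE conjE)
  have radius: "\<exists>\<epsilon>>0. \<forall>f\<in>O_step \<omega> m n. O_norm \<omega> m n f < ereal \<epsilon> \<longrightarrow> f \<in> W m" if "m \<in> F" for m
  proof -
    have "m \<ge> 1" using that F(2) by auto
    then have "openin (O_step_topology \<omega> m n) (W m \<inter> O_step \<omega> m n)"
      using W that by (intro step) auto
    moreover have "(\<lambda>_. 0) \<in> W m \<inter> O_step \<omega> m n" using W that by (simp add: zero_in_O_step)
    ultimately show ?thesis using openin_O_step_topology_nhd_zero[of \<omega> m n "W m \<inter> O_step \<omega> m n"] by simp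
  qed
  have "\<exists>\<epsilon>>0. \<forall>m\<in>F. \<forall>f\<in>O_step \<omega> m n. O_norm \<omega> m n f < ereal \<epsilon> \<longrightarrow> f \<in> W m"
  proof (rule finite_common_radius[OF F(1) radius])
    fix m \<epsilon> and \<delta> :: real
    assume *: "\<forall>f\<in>O_step \<omega> m n. O_norm \<omega> m n f < ereal \<epsilon> \<longrightarrow> f \<in> W m" "\<delta> \<le> \<epsilon>"
    have "O_norm \<omega> m n f < ereal \<epsilon>" if "O_norm \<omega> m n f < ereal \<delta>" for f :: "real^'n \<Rightarrow> complex"
      using that by (rule less_le_trans) (use *(2) in simp)
    with *(1) show "\<forall>f\<in>O_step \<omega> m n. O_norm \<omega> m n f < ereal \<delta> \<longrightarrow> f \<in> W m" by simp
  qed assumption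
  then obtain \<epsilon> where \<epsilon>: "\<epsilon> > 0" "\<forall>m\<in>F. \<forall>f\<in>O_step \<omega> m n. O_norm \<omega> m n f < ereal \<epsilon> \<longrightarrow> f \<in> W m"
    by blast
  have "f \<in> V" if f: "f \<in> (\<Inter>m\<in>{1..}. O_step \<omega> m n)" "\<forall>m\<in>F. O_norm \<omega> m n f < ereal \<epsilon>" for f
  proof (rule WV[rule_format])
    show "f \<in> (\<Inter>m\<in>{1..}. topspace (T m))" using f(1) sub by auto
    show "f \<in> W m" if "m \<in> F" for m using f \<epsilon>(2) F(2) that by auto
  qed
  then show ?thesis using F \<epsilon>(1) by (intro exI[of _ F] exI[of _ \<epsilon>]) simp
qed

text \<open>The projective limit is outermost: a functional is tested on one level \<open>m\<close>
  and there on every step \<open>n\<close>, while a neighbourhood of zero involves finitely many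
  levels, each traced on n = 1.\<close>

lemma discontinuous_convolution_O_M:
  assumes w: "nonquasianalytic_weight \<omega>" and o: "(\<lambda>t. ln (1 + t)) \<in> o[at_top](\<omega>)"
  shows "discontinuous_map
      (prod_topology (O_M \<omega> :: (real^'n::finite \<Rightarrow> complex) topology) (strong_dual (O_M \<omega>)))
      (O_M \<omega>) (\<lambda>(f, T). convolution T f)"
proof (rule discontinuous_convolution[OF w o])
  note top = topspace_O_M[OF w, where 'n = 'n]
  note closed = lincomb_closed_UN_O_step[OF w, where 'n = 'n]
  let ?T = "\<lambda>m. lc_inductive_limit {1..} (O_step_topology \<omega> m) :: (real^'n \<Rightarrow> complex) topology"
  have top_T: "topspace (?T m) = (\<Union>n\<in>{1..}. O_step \<omega> m n)" for m
    using topspace_lc_inductive_limit'[where I = "{1..}" and T = "O_step_topology \<omega> m"] closed[of m] by simp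
  show "lincomb_closed (topspace (O_M \<omega> :: (real^'n \<Rightarrow> complex) topology))"
    unfolding top by (intro lincomb_closed_INT closed)
  show "(\<Inter>m\<in>{1..}. O_step \<omega> m 1) \<subseteq> topspace (O_M \<omega> :: (real^'n \<Rightarrow> complex) topology)"
    unfolding top by fastforce
  show "topspace (O_M \<omega>) \<subseteq> (\<Union>n\<in>{1..}. O_step \<omega> m n :: (real^'n \<Rightarrow> complex) set)" if "m \<ge> 1" for m
    unfolding top using that by blast
  show "continuous_map (O_M \<omega>) euclidean L"
    if "m \<ge> 1" "C > 0" and L: "linear_functional_on (\<Union>n\<in>{1..}. O_step \<omega> m n) L"
      and bd: "\<And>n f. f \<in> O_step \<omega> m n \<Longrightarrow> ereal (cmod (L f)) \<le> ereal C * O_norm \<omega> m n f"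
    for m C and L :: "(real^'n \<Rightarrow> complex) \<Rightarrow> complex"
    unfolding O_M_def
  proof (rule continuous_map_projective_limit)
    show "continuous_map (?T m) euclidean L"
    proof (rule continuous_map_lc_inductive_limit)
      show "continuous_map (O_step_topology \<omega> m n) euclidean L" if "n \<in> {1..}" for n
        by (rule continuous_map_O_step_topology[OF linear_functional_on_subset[OF L] bd \<open>C > 0\<close>])
          (use that in auto)
    qed (use closed L in simp_all)
  qed (use that in simp)
  show "\<exists>F \<epsilon>. finite F \<and> F \<subseteq> {1..} \<and> \<epsilon> > 0 \<and>
      (\<forall>f\<in>\<Inter>m\<in>{1..}. O_step \<omega> m 1. (\<forall>m\<in>F. O_norm \<omega> m 1 f < ereal \<epsilon>) \<longrightarrow> f \<in> V)"
    if "openin (O_M \<omega>) V" "(\<lambda>_. 0) \<in> V" for V :: "(real^'n \<Rightarrow> complex) set"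
  proof (rule projective_limit_nhd_zero)
    show "openin (projective_limit {1..} ?T) V" using that by (simp add: O_M_def)
    show "openin (O_step_topology \<omega> m 1) (W \<inter> O_step \<omega> m 1)" if "openin (?T m) W" for m W
      using openin_lc_inductive_limit_step[OF _ that, of 1] by simp
    show "O_step \<omega> m 1 \<subseteq> topspace (?T m)" for m unfolding top_T by force
  qed (use that in simp)
qed

text \<open>The inductive limit is outermost: a functional is tested on every \<open>n\<close>, and
  there on the single level \<open>m\<close>.\<close>

lemma discontinuous_convolution_O_C:
  assumes w: "nonquasianalytic_weight \<omega>" and o: "(\<lambda>t. ln (1 + t)) \<in> o[at_top](\<omega>)"
  shows "discontinuous_map
      (prod_topology (O_C \<omega> :: (real^'n::finite \<Rightarrow> complex) topology) (strong_dual (O_C \<omega>)))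
      (O_C \<omega>) (\<lambda>(f, T). convolution T f)"
proof (rule discontinuous_convolution[OF w o])
  note top = topspace_O_C[OF w, where 'n = 'n]
  note closed = lincomb_closed_UN_INT_O_step[OF w, where 'n = 'n]
  let ?T = "\<lambda>n. projective_limit {1..} (\<lambda>m. O_step_topology \<omega> m n) :: (real^'n \<Rightarrow> complex) topology"
  have top_T: "topspace (?T n) = (\<Inter>m\<in>{1..}. O_step \<omega> m n)" for n
    by (simp add: topspace_projective_limit)
  show "lincomb_closed (topspace (O_C \<omega> :: (real^'n \<Rightarrow> complex) topology))"
    unfolding top by (rule closed)
  show "(\<Inter>m\<in>{1..}. O_step \<omega> m 1) \<subseteq> topspace (O_C \<omega> :: (real^'n \<Rightarrow> complex) topology)"
    unfolding top by fastforce
  show sub: "topspace (O_C \<omega>) \<subseteq> (\<Union>n\<in>{1..}. O_step \<omega> m n :: (real^'n \<Rightarrow> complex) set)" if "m \<ge> 1" for m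
    unfolding top using that by blast
  show "continuous_map (O_C \<omega>) euclidean L"
    if m: "m \<ge> 1" and "C > 0" and L: "linear_functional_on (\<Union>n\<in>{1..}. O_step \<omega> m n) L"
      and bd: "\<And>n f. f \<in> O_step \<omega> m n \<Longrightarrow> ereal (cmod (L f)) \<le> ereal C * O_norm \<omega> m n f"
    for m C and L :: "(real^'n \<Rightarrow> complex) \<Rightarrow> complex"
    unfolding O_C_def
  proof (rule continuous_map_lc_inductive_limit)
    show "linear_functional_on (\<Union>n\<in>{1..}. topspace (?T n)) L"
      using linear_functional_on_subset[OF L sub[OF m]] unfolding top top_T .
    show "continuous_map (?T n) euclidean L" if "n \<in> {1..}" for n
    proof (rule continuous_map_projective_limit)
      show "continuous_map (O_step_topology \<omega> m n) euclidean L"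
        by (rule continuous_map_O_step_topology[OF linear_functional_on_subset[OF L] bd \<open>C > 0\<close>])
          (use that in auto)
    qed (use m in simp)
  qed (use closed top_T in simp)
  show "\<exists>F \<epsilon>. finite F \<and> F \<subseteq> {1..} \<and> \<epsilon> > 0 \<and>
      (\<forall>f\<in>\<Inter>m\<in>{1..}. O_step \<omega> m 1. (\<forall>m\<in>F. O_norm \<omega> m 1 f < ereal \<epsilon>) \<longrightarrow> f \<in> V)"
    if V: "openin (O_C \<omega>) V" "(\<lambda>_. 0) \<in> V" for V :: "(real^'n \<Rightarrow> complex) set"
  proof -
    \<comment> \<open>The trace on the step n = 1 is a neighbourhood of zero in a projective limit
      of normed spaces, where finitely many norms decide.\<close>
    have "openin (?T 1) (V \<inter> topspace (?T 1))"
      by (rule openin_lc_inductive_limit_step[of 1 "{1..}" ?T]) (use V in \<open>simp_all add: O_C_def\<close>)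
    moreover have "(\<lambda>_. 0) \<in> V \<inter> topspace (?T 1)"
      using V(2) zero_in_O_step unfolding top_T by blast
    ultimately have "\<exists>F \<epsilon>. finite F \<and> F \<subseteq> {1..} \<and> \<epsilon> > 0 \<and>
      (\<forall>f\<in>\<Inter>m\<in>{1..}. O_step \<omega> m 1. (\<forall>m\<in>F. O_norm \<omega> m 1 f < ereal \<epsilon>) \<longrightarrow> f \<in> V \<inter> topspace (?T 1))"
      by (rule projective_limit_nhd_zero)
        (simp_all add: openin_Int openin_topspace[of "O_step_topology \<omega> _ 1", simplified])
    then show ?thesis by blast
  qed
qed

theorem proposition4p8:
  fixes \<omega> :: "real \<Rightarrow> real"
  assumes "nonquasianalytic_weight \<omega>"
    and "(\<lambda>t. ln (1 + t)) \<in> o[at_top](\<omega>)"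
  shows "discontinuous_map
           (prod_topology (O_M \<omega> :: (real^'n::finite \<Rightarrow> complex) topology) (strong_dual (O_M \<omega>)))
           (O_M \<omega>) (\<lambda>(f, T). convolution T f)
       \<and> discontinuous_map
           (prod_topology (O_C \<omega> :: (real^'n::finite \<Rightarrow> complex) topology) (strong_dual (O_C \<omega>)))
           (O_C \<omega>) (\<lambda>(f, T). convolution T f)"
  using assms by (intro conjI discontinuous_convolution_O_M discontinuous_convolution_O_C)

end
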